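(* Let $S_1\colon H_1\to\mathcal{G}_1$ be a compact linear operator between real Hilbert spaces and let $\lambda=(\lambda_m)_{m\in\mathbb{N}}$ be the sequence of eigenvalues of $W_1=S_1^\dagger S_1$ with respect to a non-increasing ordering (extended by zeros). Assume $\lambda_2>0$, and for every $d>1$ let $\emptyset\ne I_d\subseteq\{1,\dots,d\}$ be fixed ($I_1=\{1\}$). Consider the restriction $S_I=(S_{d,I_d})_{d\in\mathbb{N}}$ of the tensor product problem $S=(S_d\colon H_d\to\mathcal{G}_d)_{d\in\mathbb{N}}$ to the $I_d$-antisymmetric subspaces $\mathfrak{A}_{I_d}(H_d)\subseteq H_d$, in the worst case setting with respect to the absolute error criterion. If $\lambda_1<1$, then the following statements are equivalent: - $S_I$ is strongly polynomially tractable. - $S_I$ is polynomially tractable. - There exists a constant $\tau\in(0,\infty)$ such that $\lambda\in\ell_\tau$. Moreover, the same equivalences hold true if $\lambda_1\ge1$ and the number of antisymmetric coordinates $\#I_d$ grows linearly with the dimension $d$ (i.e. $\#I_d\in\Theta(d)$, as $d\to\infty$).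
   Context: $H_d=H_1\otimes\cdots\otimes H_1$ and $\mathcal{G}_d=\mathcal{G}_1\otimes\cdots\otimes\mathcal{G}_1$ are $d$-fold Hilbert space tensor products and $S_d=S_1\otimes\cdots\otimes S_1$. Eigenvalues are counted with multiplicity; if only finitely many are positive, the sequence $\lambda$ is extended by zeros. For $\emptyset\neq I\subseteq\{1,\dots,d\}$ let $\mathcal{S}_I$ be the set of permutations of $\{1,\dots,d\}$ that fix every element outside $I$, with $(-1)^{|\pi|}$ the sign of $\pi$; for $\pi\in\mathcal{S}_I$ let $U_\pi$ be the unitary operator on $H_d$ determined by $U_\pi(f_1\otimes\cdots\otimes f_d)=f_{\pi(1)}\otimes\cdots\otimes f_{\pi(d)}$. The antisymmetrizer $\mathfrak{A}_I=\frac1{\#\mathcal{S}_I}\sum_{\pi\in\mathcal{S}_I}(-1)^{|\pi|}U_\pi$ is an orthogonal projection; its range $\mathfrak{A}_I(H_d)$ is the $I$-antisymmetric subspace, equipped with the inner product of $H_d$. $S_{d,I_d}$ is the restriction of $S_d$ to $\mathfrak{A}_{I_d}(H_d)$. Worst case setting: with $\mathcal{F}_d=\mathfrak{A}_{I_d}(H_d)$, $e(n,d)=\inf_A\sup_{f\in\mathcal{F}_d,\|f\|\le1}\|S_df-Af\mid\mathcal{G}_d\|$, the infimum over linear algorithms $Af=\sum_{j=1}^nL_j(f)g_j$ with continuous linear functionals $L_j$ on $\mathcal{F}_d$ and $g_j\in\mathcal{G}_d$; $n(\varepsilon,d)=\min\{n\in\mathbb{N}_0\mid e(n,d)\le\varepsilon\}$.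 Polynomial tractability: there are $C,p>0$, $q\ge0$ with $n(\varepsilon,d)\le C\varepsilon^{-p}d^q$ for all $\varepsilon\in(0,1]$, $d\in\mathbb{N}$; strong polynomial tractability: this holds with $q=0$. *)

theory Defs
  imports
    "HOL-Analysis.Analysis"
    "HOL-Combinatorics.Permutations"
    "HOL-Library.Landau_Symbols"
begin

section \<open>Operators\<close>

definition compact_operator :: "('a::real_normed_vector \<Rightarrow> 'b::real_normed_vector) \<Rightarrow> bool" where
  "compact_operator S \<longleftrightarrow> bounded_linear S \<and> compact (closure (S ` cball 0 1))"

text \<open>Boundedness and linearity on a linear subspace \<open>V\<close>; values outside \<open>V\<close> are irrelevant.\<close>

definition bounded_linear_on ::
    "'a::real_normed_vector set \<Rightarrow> ('a \<Rightarrow> 'b::real_normed_vector) \<Rightarrow> bool" where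
  "bounded_linear_on V T \<longleftrightarrow>
     (\<forall>x\<in>V. \<forall>y\<in>V. T (x + y) = T x + T y) \<and>
     (\<forall>c. \<forall>x\<in>V. T (c *\<^sub>R x) = c *\<^sub>R T x) \<and>
     (\<exists>K. \<forall>x\<in>V. norm (T x) \<le> K * norm x)"

text \<open>
  \<open>lam\<close> lists the eigenvalues of the compact positive operator \<open>W\<close> in non-increasing order, each
  positive one as often as its (finite) multiplicity, extended by zeros if there are only finitely
  many positive ones. The indexing starts at 0, so \<open>lam 0\<close> is the largest eigenvalue.
\<close>

definition eigenvalue_seq :: "('a::real_vector \<Rightarrow> 'a) \<Rightarrow> (nat \<Rightarrow> real) \<Rightarrow> bool" where
  "eigenvalue_seq W lam \<longleftrightarrow>
     decseq lam \<and> (\<forall>m. 0 \<le> lam m) \<and>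
     (\<forall>\<mu>>0. finite {m. lam m = \<mu>} \<and> card {m. lam m = \<mu>} = dim {x. W x = \<mu> *\<^sub>R x})"

section \<open>Hilbert space tensor powers\<close>

text \<open>
  A realization of the tensor powers of \<open>'a\<close>, all inside one Hilbert space \<open>'h\<close>: \<open>t d f\<close> is the
  simple tensor \<open>f 1 \<otimes> \<dots> \<otimes> f d\<close>. The inner product of simple tensors determines the
  tensor power up to isometry; in particular it forces \<open>t d f\<close> to be multilinear and to depend
  only on \<open>f 1, \<dots>, f d\<close>. The \<open>d\<close>-th power is the closed linear span of the simple tensors. One can
  take for \<open>'h\<close> the Hilbert space direct sum of all the powers, so using a single type is no
  restriction.
\<close>

definition tensor_realization ::
    "(nat \<Rightarrow> (nat \<Rightarrow> 'a::real_inner) \<Rightarrow> 'h::{real_inner,complete_space}) \<Rightarrow> bool" where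
  "tensor_realization t \<longleftrightarrow>
     (\<forall>d\<ge>1. \<forall>f g. inner (t d f) (t d g) = (\<Prod>i=1..d. inner (f i) (g i)))"

definition tensor_space ::
    "(nat \<Rightarrow> (nat \<Rightarrow> 'a) \<Rightarrow> 'h::real_normed_vector) \<Rightarrow> nat \<Rightarrow> 'h set" where
  "tensor_space t d = closure (span (range (t d)))"

text \<open>
  The bounded operator on the \<open>d\<close>-th tensor power with prescribed values \<open>\<phi> f\<close> on the simple tensors
  \<open>t d f\<close>. If it exists, it is unique on \<open>tensor_space t d\<close> by density.
\<close>

definition tensor_lift ::
    "(nat \<Rightarrow> (nat \<Rightarrow> 'a) \<Rightarrow> 'h::real_normed_vector) \<Rightarrow> nat \<Rightarrow>
     ((nat \<Rightarrow> 'a) \<Rightarrow> 'k::real_normed_vector) \<Rightarrow> 'h \<Rightarrow> 'k" where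
  "tensor_lift t d \<phi> = (SOME T. bounded_linear_on (tensor_space t d) T \<and> (\<forall>f. T (t d f) = \<phi> f))"

definition tensor_operator ::
    "(nat \<Rightarrow> (nat \<Rightarrow> 'a) \<Rightarrow> 'h::real_normed_vector) \<Rightarrow>
     (nat \<Rightarrow> (nat \<Rightarrow> 'b) \<Rightarrow> 'k::real_normed_vector) \<Rightarrow> ('a \<Rightarrow> 'b) \<Rightarrow> nat \<Rightarrow> 'h \<Rightarrow> 'k" where
  "tensor_operator t u S d = tensor_lift t d (\<lambda>f. u d (S \<circ> f))"

definition perm_operator ::
    "(nat \<Rightarrow> (nat \<Rightarrow> 'a) \<Rightarrow> 'h::real_normed_vector) \<Rightarrow> nat \<Rightarrow> (nat \<Rightarrow> nat) \<Rightarrow> 'h \<Rightarrow> 'h" where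
  "perm_operator t d \<pi> = tensor_lift t d (\<lambda>f. t d (f \<circ> \<pi>))"

definition antisymmetrizer ::
    "(nat \<Rightarrow> (nat \<Rightarrow> 'a) \<Rightarrow> 'h::real_normed_vector) \<Rightarrow> nat \<Rightarrow> nat set \<Rightarrow> 'h \<Rightarrow> 'h" where
  "antisymmetrizer t d I x =
     (1 / real (card {\<pi>. \<pi> permutes I})) *\<^sub>R
       (\<Sum>\<pi> | \<pi> permutes I. of_int (sign \<pi>) *\<^sub>R perm_operator t d \<pi> x)"

definition antisymmetric_space ::
    "(nat \<Rightarrow> (nat \<Rightarrow> 'a) \<Rightarrow> 'h::real_normed_vector) \<Rightarrow> nat \<Rightarrow> nat set \<Rightarrow> 'h set" where
  "antisymmetric_space t d I = antisymmetrizer t d I ` tensor_space t d"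

section \<open>Worst case information complexity and tractability\<close>

definition linear_algorithms ::
    "'h::real_normed_vector set \<Rightarrow> 'k::real_normed_vector set \<Rightarrow> nat \<Rightarrow> ('h \<Rightarrow> 'k) set" where
  "linear_algorithms F G n =
     {A. \<exists>(L :: nat \<Rightarrow> 'h \<Rightarrow> real) g.
        (\<forall>j\<in>{1..n}. bounded_linear_on F (L j) \<and> g j \<in> G) \<and> A = (\<lambda>f. \<Sum>j=1..n. L j f *\<^sub>R g j)}"

text \<open>
  For an operator \<open>S\<close> that is bounded on the subspace \<open>F\<close>, the suprema below are over nonempty bounded
  sets, and the infimum is over a nonempty set of nonnegative reals.
\<close>

definition minimal_error ::
    "'h::real_normed_vector set \<Rightarrow> 'k::real_normed_vector set \<Rightarrow> ('h \<Rightarrow> 'k) \<Rightarrow> nat \<Rightarrow> real" where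
  "minimal_error F G S n =
     (INF A\<in>linear_algorithms F G n. SUP f\<in>{f \<in> F. norm f \<le> 1}. norm (S f - A f))"

text \<open>The minimum exists for \<open>\<epsilon> > 0\<close> if \<open>S\<close> is compact on \<open>F\<close>, as the minimal errors then tend to 0.\<close>

definition info_complexity ::
    "'h::real_normed_vector set \<Rightarrow> 'k::real_normed_vector set \<Rightarrow> ('h \<Rightarrow> 'k) \<Rightarrow> real \<Rightarrow> nat" where
  "info_complexity F G S \<epsilon> = (LEAST n. minimal_error F G S n \<le> \<epsilon>)"

definition antisym_complexity ::
    "(nat \<Rightarrow> (nat \<Rightarrow> 'a) \<Rightarrow> 'h::real_normed_vector) \<Rightarrow>
     (nat \<Rightarrow> (nat \<Rightarrow> 'b) \<Rightarrow> 'k::real_normed_vector) \<Rightarrow> ('a \<Rightarrow> 'b) \<Rightarrow> (nat \<Rightarrow> nat set) \<Rightarrow>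
     real \<Rightarrow> nat \<Rightarrow> nat" where
  "antisym_complexity t u S I \<epsilon> d =
     info_complexity (antisymmetric_space t d (I d)) (tensor_space u d) (tensor_operator t u S d) \<epsilon>"

definition tractability_bound :: "(real \<Rightarrow> nat \<Rightarrow> nat) \<Rightarrow> real \<Rightarrow> bool" where
  "tractability_bound n q \<longleftrightarrow>
     (\<exists>C>0. \<exists>p>0. \<forall>\<epsilon>\<in>{0<..1}. \<forall>d\<ge>1. real (n \<epsilon> d) \<le> C * \<epsilon> powr (-p) * real d powr q)"

definition polynomially_tractable :: "(real \<Rightarrow> nat \<Rightarrow> nat) \<Rightarrow> bool" where
  "polynomially_tractable n \<longleftrightarrow> (\<exists>q\<ge>0. tractability_bound n q)"

definition strongly_polynomially_tractable :: "(real \<Rightarrow> nat \<Rightarrow> nat) \<Rightarrow> bool" where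
  "strongly_polynomially_tractable n \<longleftrightarrow> tractability_bound n 0"

end

theory Submission
  imports Defs
begin

text \<open>
  The products \<open>ev k\<close> of the eigenvalues over a multi-index \<open>k\<close> are the squared singular values of the
  tensor product problem. On the antisymmetric subspace, the multi-indices that contribute are
  injective on \<open>I\<close> and count only up to permutations of \<open>I\<close>, so
  \<open>n \<epsilon> d \<le> #{k. ev k > \<epsilon>\<^sup>2} / (#I)! \<le> \<epsilon> powr (-2\<tau>) * (\<Sum>m. lam m powr \<tau>) ^ d / (#I)!\<close>.
  If \<open>lam 0 < 1\<close>, enlarging \<open>\<tau>\<close> makes the sum at most 1; if \<open>#I\<close> grows linearly in \<open>d\<close>, the
  factorial beats the exponential. Conversely, polynomial tractability for the single dimension
  \<open>d = 1\<close>, where \<open>n\<close> functionals leave an error of at least \<open>sqrt (lam n)\<close>, already forces polynomial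
  decay of the eigenvalues.
\<close>

section \<open>Hilbert spaces\<close>

text \<open>Several notions are choices: \<open>adjoint\<close> and \<open>tensor_lift\<close> pick
  some map with a prescribed property, so nothing can be said about them before such a map has been
  constructed. The adjoint comes from Riesz representation, the permutation operators from the fact
  that reordering factors is isometric, and the tensor power of the operator, which is not
  isometric, from its singular value series.

  That series requires the spectral theorem. \<open>eigenvalue_seq\<close> speaks only of
  multiplicities of positive eigenvalues, so finite multiplicity, decay to 0 and completeness of the
  eigenvectors up to the kernel all have to be drawn from compactness.

  Tensor spaces are known only through inner products of simple tensors. Hence antisymmetry is
  expressed through the coefficients \<open>inner x (left k)\<close>, and identities of operators
  are checked on simple tensors and extended by density.

  The single dimension \<open>d = 1\<close> suffices for the converse because there the factor
  \<open>d powr q\<close> is 1 for every \<open>q\<close>, and because \<open>I 1\<close> can only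
  be \<open>{1}\<close>, so that antisymmetry is no restriction.\<close>

lemma parallelogram_law:
  fixes x y :: "'a::real_inner"
  shows "(norm (x + y))\<^sup>2 + (norm (x - y))\<^sup>2 = 2 * (norm x)\<^sup>2 + 2 * (norm y)\<^sup>2"
  by (simp add: power2_norm_eq_inner inner_add inner_diff inner_commute)

text \<open>The representing vector is the minimizer of \<open>\<parallel>x\<parallel>\<^sup>2 - 2 \<phi> x\<close>; minimizing sequences are Cauchy by
  the parallelogram law.\<close>

lemma Riesz_representation:
  fixes \<phi> :: "'a::{real_inner,complete_space} \<Rightarrow> real"
  assumes "bounded_linear \<phi>"
  shows "\<exists>z. \<forall>x. \<phi> x = inner x z"
proof -
  interpret bounded_linear \<phi> by fact
  define J where "J x = (norm x)\<^sup>2 - 2 * \<phi> x" for x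
  obtain K where K: "\<And>x. \<bar>\<phi> x\<bar> \<le> norm x * K" using bounded by auto
  have low: "J x \<ge> - K\<^sup>2" for x
  proof -
    have "0 \<le> (norm x - K)\<^sup>2" by simp
    moreover have "\<phi> x \<le> norm x * K" using K[of x] by simp
    ultimately show ?thesis by (simp add: J_def power2_diff)
  qed
  define m where "m = Inf (range J)"
  have bdd: "bdd_below (range J)" using low by (meson bdd_belowI2)
  have mle: "m \<le> J x" for x unfolding m_def by (rule cInf_lower) (use bdd in auto)
  have "\<exists>x. J x < m + 1 / real (Suc n)" for n
  proof -
    have "Inf (range J) < m + 1 / real (Suc n)" by (simp add: m_def)
    then show ?thesis using cInf_lessD[of "range J"] by auto
  qed
  then obtain X where X: "\<And>n. J (X n) < m + 1 / real (Suc n)" by metis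
  have dist: "(norm (x - y))\<^sup>2 \<le> 2 * (J x + J y - 2 * m)" for x y
  proof -
    have "J x + J y = 2 * J ((1/2) *\<^sub>R (x + y)) + (norm (x - y))\<^sup>2 / 2"
    proof -
      have "(norm ((1/2) *\<^sub>R (x + y)))\<^sup>2 = (norm (x + y))\<^sup>2 / 4"
        by (simp only: norm_scaleR) (simp add: power_divide)
      moreover have "\<phi> ((1/2) *\<^sub>R (x + y)) = (\<phi> x + \<phi> y) / 2"
        by (simp only: scaleR add) simp
      ultimately show ?thesis using parallelogram_law[of x y]
        by (simp only: J_def) (simp add: field_simps)
    qed
    then show ?thesis using mle[of "(1/2) *\<^sub>R (x + y)"] by simp
  qed
  have "Cauchy X"
  proof (rule metric_CauchyI)
    fix e :: real assume "e > 0"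
    obtain N where N: "1 / real (Suc N) < e\<^sup>2 / 4" using \<open>e > 0\<close> nat_approx_posE[of "e\<^sup>2/4"] by auto
    have J: "J (X n) < m + e\<^sup>2 / 4" if "n \<ge> N" for n
    proof -
      have "1 / real (Suc n) \<le> 1 / real (Suc N)" using that by (simp add: frac_le)
      then show ?thesis using X[of n] N by linarith
    qed
    have "dist (X i) (X j) < e" if "i \<ge> N" "j \<ge> N" for i j
    proof -
      have "(norm (X i - X j))\<^sup>2 < e\<^sup>2" using dist[of "X i" "X j"] J[OF that(1)] J[OF that(2)] by argo
      then show ?thesis using \<open>e > 0\<close> by (simp add: dist_norm power_less_imp_less_base)
    qed
    then show "\<exists>M. \<forall>i\<ge>M. \<forall>j\<ge>M. dist (X i) (X j) < e" by blast
  qed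
  then obtain z where z: "X \<longlonglongrightarrow> z" using Cauchy_convergent convergentD by blast
  have "(\<lambda>n. J (X n)) \<longlonglongrightarrow> J z" unfolding J_def by (intro tendsto_intros z tendsto)
  moreover have "(\<lambda>n. m + 1 / real (Suc n)) \<longlonglongrightarrow> m + 0"
    by (intro tendsto_intros LIMSEQ_Suc[OF lim_1_over_n])
  ultimately have "J z \<le> m + 0" using X by (intro LIMSEQ_le) (auto intro: less_imp_le)
  then have min: "J z \<le> J x" for x using mle[of x] by simp
  have "\<phi> y = inner y z" for y
  proof (cases "y = 0")
    case False
    define c where "c = inner y z - \<phi> y"
    define r where "r = (norm y)\<^sup>2"
    have r: "r > 0" using False by (simp add: r_def)
    have J_line: "J (z + s *\<^sub>R y) = J z + s\<^sup>2 * r + 2 * s * c" for s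
    proof -
      have "(norm (z + s *\<^sub>R y))\<^sup>2 = (norm z)\<^sup>2 + s\<^sup>2 * r + 2 * s * inner y z"
        unfolding r_def power2_norm_eq_inner
        by (simp add: inner_add_left inner_add_right inner_commute[of z y] power2_eq_square
            algebra_simps del: norm_eq_sqrt_inner)
      then show ?thesis by (simp add: J_def add scaleR c_def algebra_simps)
    qed
    \<comment> \<open>The parameter \<open>- c / r\<close> minimizes the quadratic
      \<open>s^2 * r + 2 * s * c\<close>. Its value there is \<open>- c^2 / r\<close>, which
      minimality of \<open>z\<close> forbids to be negative.\<close>
    have "J (z + (- c / r) *\<^sub>R y) = J z + (- c / r)\<^sup>2 * r + 2 * (- c / r) * c" by (rule J_line)
    also have "\<dots> = J z - c\<^sup>2 / r" using r by (simp add: power2_eq_square field_simps)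
    finally have "c\<^sup>2 / r \<le> 0" using min[of "z + (- c / r) *\<^sub>R y"] by simp
    then have "c = 0" using r by (simp add: divide_le_0_iff)
    then show ?thesis by (simp add: c_def)
  qed (simp add: zero)
  then show ?thesis by blast
qed

text \<open>Since \<open>adjoint\<close> is a choice, its characteristic identity holds only once
  some adjoint exists. Riesz representation, applied to \<open>inner (S x) y\<close> as a functional
  of \<open>x\<close> for each \<open>y\<close>, provides one in infinite dimension.\<close>

lemma inner_adjoint:
  fixes S :: "'a::{real_inner,complete_space} \<Rightarrow> 'b::real_inner"
  assumes "bounded_linear S"
  shows "inner x (adjoint S y) = inner (S x) y"
proof -
  have "\<exists>z. \<forall>x. inner (S x) y = inner x z" for y
    using Riesz_representation[OF bounded_linear_compose[OF bounded_linear_inner_left assms]] by blast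
  then have "\<exists>f. \<forall>x y. inner (S x) y = inner x (f y)" by metis
  then show ?thesis unfolding adjoint_def by (rule someI2_ex) simp
qed

text \<open>Gram-Schmidt. A vector whose remainder \<open>r\<close> vanishes is dropped, so that
  every remaining one can be normalized, even if \<open>B\<close> is linearly dependent.\<close>

lemma orthonormal_basis_of_span:
  fixes B :: "'a::real_inner set"
  assumes "finite B"
  obtains C where "finite C" "pairwise orthogonal C" "\<And>c. c \<in> C \<Longrightarrow> norm c = 1" "span C = span B"
proof -
  have "\<exists>C. finite C \<and> pairwise orthogonal C \<and> (\<forall>c\<in>C. norm c = 1) \<and> span C = span B"
    using assms
  proof induction
    case empty
    show ?case by (intro exI[of _ "{}"]) auto
  next
    case (insert b B)
    then obtain C where C: "finite C" "pairwise orthogonal C" "\<forall>c\<in>C. norm c = 1" "span C = span B"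
      by blast
    define p where "p = (\<Sum>c\<in>C. inner b c *\<^sub>R c)"
    define r where "r = b - p"
    have p: "p \<in> span C" unfolding p_def by (intro span_sum span_scale span_base)
    have orth: "inner r c = 0" if "c \<in> C" for c
    proof -
      have "inner p c = (\<Sum>c'\<in>C. if c' = c then inner b c else 0)"
        unfolding p_def inner_sum_left
        by (rule sum.cong) (use C that in \<open>auto simp: pairwise_def orthogonal_def norm_eq_1\<close>)
      then show ?thesis using C that by (simp add: r_def inner_diff)
    qed
    have span: "span (insert r C) = span (insert b B)"
    proof -
      have "span (insert r C) = span (insert b C)"
        by (rule eq_span_insert_eq) (use p in \<open>simp add: r_def span_neg\<close>)
      then show ?thesis using C(4) by (simp add: span_insert)
    qed
    show ?case
    proof (cases "r = 0")
      case True
      then have "span C = span (insert b B)" using span by (simp add: span_insert_0)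
      then show ?thesis using C by blast
    next
      case False
      let ?r = "(1 / norm r) *\<^sub>R r"
      have "span (insert ?r C) = span (insert r C)"
      proof -
        have "span (insert ?r C) = {x. \<exists>k. x - k *\<^sub>R ?r \<in> span C}" by (rule span_insert)
        also have "\<dots> = {x. \<exists>k. x - k *\<^sub>R r \<in> span C}"
        proof (intro Collect_cong iffI; elim exE)
          fix x k assume "x - k *\<^sub>R ?r \<in> span C"
          then show "\<exists>k. x - k *\<^sub>R r \<in> span C" by (intro exI[of _ "k / norm r"]) simp
        next
          fix x k assume "x - k *\<^sub>R r \<in> span C"
          then show "\<exists>k. x - k *\<^sub>R ?r \<in> span C" using False by (intro exI[of _ "k * norm r"]) simp
        qed
        finally show ?thesis by (simp add: span_insert)
      qed
      moreover have "pairwise orthogonal (insert ?r C)"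
        using C(2) orth by (auto simp: pairwise_insert orthogonal_def inner_commute)
      ultimately show ?thesis using C span False
        by (intro exI[of _ "insert ?r C"]) auto
    qed
  qed
  then show ?thesis using that by blast
qed

section \<open>Bounded operators on a closed span\<close>

lemma bounded_linear_onI:
  assumes "\<And>x y. x \<in> V \<Longrightarrow> y \<in> V \<Longrightarrow> T (x + y) = T x + T y"
    and "\<And>c x. x \<in> V \<Longrightarrow> T (c *\<^sub>R x) = c *\<^sub>R T x"
    and "\<And>x. x \<in> V \<Longrightarrow> norm (T x) \<le> K * norm x"
  shows "bounded_linear_on V T"
  using assms unfolding bounded_linear_on_def by blast

lemma bounded_linear_imp_on:
  assumes "bounded_linear T"
  shows "bounded_linear_on V T"
proof -
  interpret bounded_linear T by fact
  obtain K where "\<And>x. norm (T x) \<le> norm x * K" using bounded by blast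
  then show ?thesis by (intro bounded_linear_onI[where K = K]) (auto simp: add scaleR mult.commute)
qed

lemma bounded_linear_on_add:
  "bounded_linear_on V T \<Longrightarrow> x \<in> V \<Longrightarrow> y \<in> V \<Longrightarrow> T (x + y) = T x + T y"
  by (simp add: bounded_linear_on_def)

lemma bounded_linear_on_scale:
  "bounded_linear_on V T \<Longrightarrow> x \<in> V \<Longrightarrow> T (c *\<^sub>R x) = c *\<^sub>R T x"
  by (simp add: bounded_linear_on_def)

lemma bounded_linear_on_bound:
  assumes "bounded_linear_on V T"
  obtains K where "K > 0" "\<And>x. x \<in> V \<Longrightarrow> norm (T x) \<le> K * norm x"
proof -
  obtain K where K: "\<forall>x\<in>V. norm (T x) \<le> K * norm x"
    using assms unfolding bounded_linear_on_def by blast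
  show ?thesis
  proof (rule that[of "max K 1"])
    show "norm (T x) \<le> max K 1 * norm x" if "x \<in> V" for x
    proof -
      have "K * norm x \<le> max K 1 * norm x" by (intro mult_right_mono) auto
      then show ?thesis using K that by force
    qed
  qed simp
qed

lemma bounded_linear_on_diff:
  assumes "subspace V" "bounded_linear_on V T" "x \<in> V" "y \<in> V"
  shows "T (x - y) = T x - T y"
proof -
  have "T (x + (-1) *\<^sub>R y) = T x + (-1) *\<^sub>R T y"
    by (simp only: bounded_linear_on_add[OF assms(2,3) subspace_scale[OF assms(1,4)]]
        bounded_linear_on_scale[OF assms(2,4)])
  then show ?thesis by simp
qed

lemma bounded_linear_on_sum:
  assumes "subspace V" "bounded_linear_on V T" "finite A" "\<And>i. i \<in> A \<Longrightarrow> v i \<in> V"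
  shows "T (\<Sum>i\<in>A. c i *\<^sub>R v i) = (\<Sum>i\<in>A. c i *\<^sub>R T (v i))"
  using assms(3,4)
proof induction
  case empty
  have "T (0 *\<^sub>R 0) = 0 *\<^sub>R T 0"
    by (rule bounded_linear_on_scale[OF assms(2) subspace_0[OF assms(1)]])
  then show ?case by simp
next
  case (insert i A)
  then show ?case
    by (simp add: bounded_linear_on_add[OF assms(2)] bounded_linear_on_scale[OF assms(2)]
        subspace_scale[OF assms(1)] subspace_sum[OF assms(1)])
qed

lemma bounded_linear_on_sub:
  assumes "subspace V" "bounded_linear_on V T" "bounded_linear_on V T'"
  shows "bounded_linear_on V (\<lambda>x. T x - T' x)"
proof -
  obtain K where K: "\<And>x. x \<in> V \<Longrightarrow> norm (T x) \<le> K * norm x"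
    using bounded_linear_on_bound[OF assms(2)] by metis
  obtain K' where K': "\<And>x. x \<in> V \<Longrightarrow> norm (T' x) \<le> K' * norm x"
    using bounded_linear_on_bound[OF assms(3)] by metis
  show ?thesis
  proof (rule bounded_linear_onI)
    show "norm (T x - T' x) \<le> (K + K') * norm x" if "x \<in> V" for x
      using K[OF that] K'[OF that] norm_triangle_ineq4[of "T x" "T' x"]
      unfolding distrib_right by linarith
  qed (simp_all add: bounded_linear_on_add[OF assms(2)] bounded_linear_on_add[OF assms(3)]
      bounded_linear_on_scale[OF assms(2)] bounded_linear_on_scale[OF assms(3)] scaleR_diff_right)
qed

lemma bounded_linear_on_subset: "bounded_linear_on V T \<Longrightarrow> V' \<subseteq> V \<Longrightarrow> bounded_linear_on V' T"
  unfolding bounded_linear_on_def by blast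

lemma bounded_linear_on_compose:
  assumes "bounded_linear_on V T" "bounded_linear L"
  shows "bounded_linear_on V (\<lambda>x. L (T x))"
proof -
  interpret L: bounded_linear L by fact
  obtain K where K: "0 \<le> K" "\<forall>x. norm (L x) \<le> norm x * K"
    using L.nonneg_bounded by (elim exE conjE)
  obtain K' where K': "\<And>x. x \<in> V \<Longrightarrow> norm (T x) \<le> K' * norm x"
    using bounded_linear_on_bound[OF assms(1)] by metis
  show ?thesis
  proof (rule bounded_linear_onI)
    show "norm (L (T x)) \<le> (K' * K) * norm x" if "x \<in> V" for x
      using spec[OF K(2), of "T x"] mult_right_mono[OF K'[OF that] K(1)] by (simp add: ac_simps)
  qed (simp_all add: bounded_linear_on_add[OF assms(1)] bounded_linear_on_scale[OF assms(1)]
      L.add L.scaleR)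
qed

lemma bounded_linear_on_tendsto:
  assumes "subspace V" "bounded_linear_on V T" "\<And>n. X n \<in> V" "X \<longlonglongrightarrow> x" "x \<in> V"
  shows "(\<lambda>n. T (X n)) \<longlonglongrightarrow> T x"
proof -
  obtain K where K: "K > 0" "\<And>x. x \<in> V \<Longrightarrow> norm (T x) \<le> K * norm x"
    using bounded_linear_on_bound[OF assms(2)] by metis
  have "(\<lambda>n. X n - x) \<longlonglongrightarrow> 0" using assms(4) by (rule LIM_zero)
  then have "(\<lambda>n. K * norm (X n - x)) \<longlonglongrightarrow> 0"
    by (intro tendsto_mult_right_zero tendsto_norm_zero)
  then have "(\<lambda>n. T (X n) - T x) \<longlonglongrightarrow> 0"
  proof (rule Lim_null_comparison[rotated], intro always_eventually allI)
    fix n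
    show "norm (T (X n) - T x) \<le> K * norm (X n - x)"
      using K(2)[OF subspace_diff[OF assms(1,3,5)]]
      by (simp only: bounded_linear_on_diff[OF assms(1,2,3,5)])
  qed
  then show ?thesis by (rule LIM_zero_cancel)
qed

lemma subspace_closure:
  fixes V :: "'a::real_normed_vector set"
  assumes "subspace V"
  shows "subspace (closure V)"
proof (rule subspaceI)
  show "0 \<in> closure V" using subspace_0[OF assms] closure_subset by blast
next
  fix x y assume "x \<in> closure V" "y \<in> closure V"
  then obtain X Y where "\<And>n. X n \<in> V" "X \<longlonglongrightarrow> x" "\<And>n. Y n \<in> V" "Y \<longlonglongrightarrow> y"
    unfolding closure_sequential by metis
  then show "x + y \<in> closure V"
    unfolding closure_sequential
    by (intro exI[of _ "\<lambda>n. X n + Y n"]) (simp add: subspace_add[OF assms] tendsto_add)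
next
  fix c x assume "x \<in> closure V"
  then obtain X where "\<And>n. X n \<in> V" "X \<longlonglongrightarrow> x" unfolding closure_sequential by metis
  then show "c *\<^sub>R x \<in> closure V"
    unfolding closure_sequential
    by (intro exI[of _ "\<lambda>n. c *\<^sub>R X n"])
      (simp add: subspace_scale[OF assms] tendsto_scaleR[OF tendsto_const])
qed

lemma subspace_closed_span: "subspace (closure (span R))"
  for R :: "'a::real_normed_vector set"
  by (rule subspace_closure) simp

lemma closed_span_superset: "r \<in> R \<Longrightarrow> r \<in> closure (span R)"
  for R :: "'a::real_normed_vector set"
  by (meson closure_subset span_base subsetD)

text \<open>The density principle behind all later identities on \<open>tensor_space\<close>:
  linearity carries a closed linear condition from the generators to their span, continuity to the
  closure. The case \<open>W = {0}\<close>, applied to a difference, gives uniqueness of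
  operators.\<close>

lemma closed_span_mem:
  assumes T: "bounded_linear_on (closure (span R)) T" and "subspace W" "closed W"
    and R: "\<And>r. r \<in> R \<Longrightarrow> T r \<in> W" and x: "x \<in> closure (span R)"
  shows "T x \<in> W"
proof -
  let ?V = "closure (span R)"
  have span: "y \<in> ?V \<and> T y \<in> W" if "y \<in> span R" for y
    using that
  proof (induction rule: span_induct_alt)
    case base
    have "T (0 *\<^sub>R 0) = 0 *\<^sub>R T 0"
      by (rule bounded_linear_on_scale[OF T subspace_0[OF subspace_closed_span]])
    then show ?case using assms(2) by (simp add: subspace_0 subspace_closed_span)
  next
    case (step c r y)
    have r: "r \<in> ?V" using step by (simp add: closed_span_superset)
    have "T (c *\<^sub>R r + y) = c *\<^sub>R T r + T y"
      using step r
      by (simp add: bounded_linear_on_add[OF T] bounded_linear_on_scale[OF T]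
          subspace_scale[OF subspace_closed_span])
    then show ?case
      using step r R assms(2)
      by (simp add: subspace_add subspace_scale subspace_closed_span)
  qed
  obtain X where X: "\<And>n. X n \<in> span R" "X \<longlonglongrightarrow> x" using x unfolding closure_sequential by blast
  have "(\<lambda>n. T (X n)) \<longlonglongrightarrow> T x"
    using X x by (intro bounded_linear_on_tendsto[OF subspace_closed_span T]) (auto simp: span)
  then show ?thesis using \<open>closed W\<close> span[OF X(1)] by (meson closed_sequentially)
qed

lemma closed_span_unique:
  assumes "bounded_linear_on (closure (span R)) T" "bounded_linear_on (closure (span R)) T'"
    and "\<And>r. r \<in> R \<Longrightarrow> T r = T' r" "x \<in> closure (span R)"
  shows "T x = T' x"
  using closed_span_mem[OF bounded_linear_on_sub[OF subspace_closed_span assms(1,2)], of "{0}" x] assms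
  by (simp add: subspace_single_0)

text \<open>The extension is read off the closure \<open>G\<close> of its graph on the span, on which the two
  projections have equal norms.\<close>

lemma isometric_extension:
  fixes v :: "'i \<Rightarrow> 'h::{real_inner,complete_space}" and w :: "'i \<Rightarrow> 'k::{real_inner,complete_space}"
  assumes gram: "\<And>i j. inner (v i) (v j) = inner (w i) (w j)"
  shows "\<exists>T. bounded_linear_on (closure (span (range v))) T \<and> (\<forall>i. T (v i) = w i)"
proof -
  \<comment> \<open>The vectors \<open>v i\<close> may be linearly dependent, so values cannot
    simply be prescribed on them. For the graph the question becomes single-valuedness, and equality
    of norms settles it: a pair \<open>(0, y)\<close> has \<open>y = 0\<close>.\<close>
  define G0 where "G0 = span (range (\<lambda>i. (v i, w i)))"
  define G where "G = closure G0"
  have subG0: "subspace G0" by (simp add: G0_def)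
  have subG: "subspace G" unfolding G_def by (rule subspace_closure) (rule subG0)
  have base: "(v i, w i) \<in> G0" for i by (simp add: G0_def span_base)
  have inner1: "inner (fst p) (v j) = inner (snd p) (w j)" if "p \<in> G0" for p j
    using that unfolding G0_def
    by (induction rule: span_induct_alt) (auto simp: inner_add_left gram)
  have inner2: "inner (fst p) (fst q) = inner (snd p) (snd q)" if "p \<in> G0" "q \<in> G0" for p q
    using that(2) unfolding G0_def
    by (induction rule: span_induct_alt) (auto simp: inner_add_right inner1[OF that(1)])
  have norm0: "norm (fst p) = norm (snd p)" if "p \<in> G0" for p
    using inner2[OF that that] by (simp add: norm_eq_sqrt_inner)
  have norm: "norm (fst p) = norm (snd p)" if "p \<in> G" for p
  proof -
    have "closed {p::'h \<times> 'k. norm (fst p) = norm (snd p)}"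
      by (intro closed_Collect_eq continuous_intros)
    then have "G \<subseteq> {p. norm (fst p) = norm (snd p)}"
      unfolding G_def using norm0 by (intro closure_minimal) auto
    then show ?thesis using that by auto
  qed
  have func: "y = y'" if "(x, y) \<in> G" "(x, y') \<in> G" for x y y'
    using norm[OF subspace_diff[OF subG that]] by simp
  have ex: "\<exists>y. (x, y) \<in> G" if x: "x \<in> closure (span (range v))" for x
  proof -
    have lift: "\<exists>y. (x, y) \<in> G0" if "x \<in> span (range v)" for x
      using that
    proof (induction rule: span_induct_alt)
      case base
      show ?case using subspace_0[OF subG0] by (auto simp: zero_prod_def)
    next
      case (step c r x)
      then obtain i y where i: "r = v i" "(x, y) \<in> G0" by blast
      have "c *\<^sub>R (v i, w i) + (x, y) \<in> G0"
        using i by (intro subspace_add[OF subG0] subspace_scale[OF subG0] base)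
      then show ?case using i by auto
    qed
    obtain X where X: "\<And>n. X n \<in> span (range v)" "X \<longlonglongrightarrow> x"
      using x unfolding closure_sequential by blast
    obtain Y where Y: "\<And>n. (X n, Y n) \<in> G0" using lift[OF X(1)] by metis
    have iso: "dist (Y m) (Y n) = dist (X m) (X n)" for m n
      using norm0[OF subspace_diff[OF subG0 Y[of m] Y[of n]]] by (simp add: dist_norm)
    have "Cauchy X" using X(2) LIMSEQ_imp_Cauchy by blast
    then have "Cauchy Y" by (simp add: Cauchy_def iso)
    then obtain y where "Y \<longlonglongrightarrow> y" using Cauchy_convergent convergentD by blast
    then have "(\<lambda>n. (X n, Y n)) \<longlonglongrightarrow> (x, y)" using X(2) by (intro tendsto_Pair)
    then show ?thesis unfolding G_def closure_sequential using Y by (intro exI[of _ y] exI[of _ "\<lambda>n. (X n, Y n)"]) simp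
  qed
  define T where "T x = (SOME y. (x, y) \<in> G)" for x
  have T: "(x, T x) \<in> G" if "x \<in> closure (span (range v))" for x
    unfolding T_def using someI_ex[OF ex[OF that]] .
  have T_eq: "T x = y" if "(x, y) \<in> G" for x y
    unfolding T_def by (rule some_equality) (use that func in blast)+
  have "bounded_linear_on (closure (span (range v))) T"
  proof (rule bounded_linear_onI[where K = 1])
    fix x y assume "x \<in> closure (span (range v))" "y \<in> closure (span (range v))"
    then show "T (x + y) = T x + T y" using subspace_add[OF subG T T, of x y] T_eq by simp
  next
    fix c x assume "x \<in> closure (span (range v))"
    then show "T (c *\<^sub>R x) = c *\<^sub>R T x" using subspace_scale[OF subG T, of x c] T_eq by simp
  next
    fix x assume "x \<in> closure (span (range v))"
    then show "norm (T x) \<le> 1 * norm x" using norm[OF T, of x] by simp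
  qed
  moreover have "T (v i) = w i" for i
    by (rule T_eq) (use base closure_subset in \<open>auto simp: G_def\<close>)
  ultimately show ?thesis by blast
qed

section \<open>Singular systems of compact operators\<close>

lemma norm_sum_orthogonal:
  fixes v :: "'i \<Rightarrow> 'h::real_inner"
  assumes "finite A" "\<And>i j. i \<in> A \<Longrightarrow> j \<in> A \<Longrightarrow> i \<noteq> j \<Longrightarrow> inner (v i) (v j) = 0"
  shows "(norm (\<Sum>i\<in>A. c i *\<^sub>R v i))\<^sup>2 = (\<Sum>i\<in>A. (c i)\<^sup>2 * (norm (v i))\<^sup>2)"
  using norm_sum_Pythagorean[OF assms(1), of "\<lambda>i. c i *\<^sub>R v i"] assms(2)
  by (simp add: pairwise_def orthogonal_def power_mult_distrib)

lemma Bessel_inequality: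
  fixes t :: "'i \<Rightarrow> 'h::real_inner"
  assumes "finite A" "\<And>i j. i \<in> A \<Longrightarrow> j \<in> A \<Longrightarrow> i \<noteq> j \<Longrightarrow> inner (t i) (t j) = 0"
    and "\<And>i. i \<in> A \<Longrightarrow> t i = 0 \<or> norm (t i) = 1"
  shows "(\<Sum>i\<in>A. (inner x (t i))\<^sup>2) \<le> (norm x)\<^sup>2"
proof -
  define p where "p = (\<Sum>i\<in>A. inner x (t i) *\<^sub>R t i)"
  have "(norm p)\<^sup>2 = (\<Sum>i\<in>A. (inner x (t i))\<^sup>2 * (norm (t i))\<^sup>2)"
    unfolding p_def by (rule norm_sum_orthogonal[OF assms(1,2)])
  also have "\<dots> = (\<Sum>i\<in>A. (inner x (t i))\<^sup>2)"
    by (rule sum.cong) (use assms(3) in force)+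
  finally have p: "(norm p)\<^sup>2 = (\<Sum>i\<in>A. (inner x (t i))\<^sup>2)" .
  have xp: "inner x p = (\<Sum>i\<in>A. (inner x (t i))\<^sup>2)"
    by (simp add: p_def inner_sum_right power2_eq_square)
  have "0 \<le> (norm (x - p))\<^sup>2" by simp
  also have "\<dots> = (norm x)\<^sup>2 + (norm p)\<^sup>2 - 2 * inner x p"
    unfolding power2_norm_eq_inner by (simp add: inner_diff inner_commute)
  finally show ?thesis using p xp by simp
qed

text \<open>By Pythagoras, squared distances of partial sums are distances of the sums
  \<open>s\<close> of squared norms, a bounded increasing real sequence. Increasing finite sets
  \<open>C n\<close> take the place of initial segments, so that multi-indices can be exhausted by
  cubes.\<close>

lemma orthogonal_series_convergent:
  fixes v :: "'i \<Rightarrow> 'h::{real_inner,complete_space}"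
  assumes C: "\<And>n. finite (C n)" "mono C"
    and orth: "\<And>i j. i \<in> (\<Union>n. C n) \<Longrightarrow> j \<in> (\<Union>n. C n) \<Longrightarrow> i \<noteq> j \<Longrightarrow> inner (v i) (v j) = 0"
    and bound: "\<And>n. (\<Sum>i\<in>C n. (norm (v i))\<^sup>2) \<le> B"
  shows "convergent (\<lambda>n. \<Sum>i\<in>C n. v i)"
proof -
  define s where "s n = (\<Sum>i\<in>C n. (norm (v i))\<^sup>2)" for n
  define V where "V n = (\<Sum>i\<in>C n. v i)" for n
  have sub: "C m \<subseteq> C n" if "m \<le> n" for m n using C(2) that by (simp add: monoD)
  have inc: "incseq s" unfolding incseq_def s_def
    by (intro allI impI sum_mono2 C(1) sub) auto
  have "Bseq s"
    by (rule BseqI'[where K = B]) (use bound in \<open>simp add: s_def sum_nonneg\<close>)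
  then have "Cauchy s" 
    using inc by (simp add: Bseq_monoseq_convergent convergent_Cauchy incseq_imp_monoseq)
  have diff: "(norm (V n - V m))\<^sup>2 = s n - s m" if "m \<le> n" for m n
  proof -
    have "V n - V m = (\<Sum>i\<in>C n - C m. 1 *\<^sub>R v i)"
      unfolding V_def using sum_diff[OF C(1) sub[OF that], of v] by simp
    then have "(norm (V n - V m))\<^sup>2 = (\<Sum>i\<in>C n - C m. 1\<^sup>2 * (norm (v i))\<^sup>2)"
      by (simp only:) (rule norm_sum_orthogonal, use orth C(1) in auto)
    then show ?thesis unfolding s_def using sum_diff[OF C(1) sub[OF that]] by simp
  qed
  have "(dist (V m) (V n))\<^sup>2 = dist (s m) (s n)" for m n
  proof (cases "m \<le> n")
    case True
    then show ?thesis using diff[of m n] incseqD[OF inc, of m n] by (simp add: dist_norm norm_minus_commute)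
  next
    case False
    then show ?thesis using diff[of n m] incseqD[OF inc, of n m] by (simp add: dist_norm)
  qed
  note dist = this
  have "Cauchy V"
  proof (rule metric_CauchyI)
    fix \<epsilon> :: real assume "\<epsilon> > 0"
    then obtain M where M: "\<And>m n. m \<ge> M \<Longrightarrow> n \<ge> M \<Longrightarrow> dist (s m) (s n) < \<epsilon>\<^sup>2"
      using metric_CauchyD[OF \<open>Cauchy s\<close>, of "\<epsilon>\<^sup>2"] by auto
    have "dist (V m) (V n) < \<epsilon>" if "m \<ge> M" "n \<ge> M" for m n
    proof -
      have "(dist (V m) (V n))\<^sup>2 < \<epsilon>\<^sup>2" using M[OF that] by (simp only: dist)
      then show ?thesis using \<open>\<epsilon> > 0\<close> by (simp add: power_less_imp_less_base)
    qed
    then show "\<exists>M. \<forall>m\<ge>M. \<forall>n\<ge>M. dist (V m) (V n) < \<epsilon>" by blast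
  qed
  then show ?thesis unfolding V_def by (rule Cauchy_convergent)
qed

text \<open>Orthogonal images of squared norm at least \<mu> are farther apart than
  \<open>sqrt \<mu>\<close>, so each ball of radius \<open>sqrt \<mu> / 2\<close> in a finite cover
  of the image of the unit ball contains at most one. This yields both finite multiplicities and
  decay of the eigenvalues.\<close>

lemma compact_operator_orthogonal_bounded:
  fixes S :: "'a::real_normed_vector \<Rightarrow> 'b::real_inner"
  assumes "compact_operator S" "\<mu> > 0"
  obtains k where "\<And>C. finite C \<Longrightarrow> (\<And>c. c \<in> C \<Longrightarrow> norm c \<le> 1 \<and> \<mu> \<le> (norm (S c))\<^sup>2) \<Longrightarrow>
    pairwise (\<lambda>x y. inner (S x) (S y) = 0) C \<Longrightarrow> card C \<le> k"
proof -
  have "compact (closure (S ` cball 0 1))" using assms by (simp add: compact_operator_def)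
  then obtain F where F: "finite F" "closure (S ` cball 0 1) \<subseteq> (\<Union>x\<in>F. ball x (sqrt \<mu> / 2))"
    using assms(2) unfolding compact_eq_totally_bounded by (metis half_gt_zero real_sqrt_gt_0_iff)
  show ?thesis
  proof (rule that[of "card F"])
    fix C :: "'a set"
    assume C: "finite C" "\<And>c. c \<in> C \<Longrightarrow> norm c \<le> 1 \<and> \<mu> \<le> (norm (S c))\<^sup>2"
      "pairwise (\<lambda>x y. inner (S x) (S y) = 0) C"
    have "\<exists>y\<in>F. dist y (S c) < sqrt \<mu> / 2" if "c \<in> C" for c
    proof -
      have "S c \<in> S ` cball 0 1" using C(2)[OF that] by simp
      then have "S c \<in> (\<Union>x\<in>F. ball x (sqrt \<mu> / 2))" using F(2) closure_subset by (meson subsetD)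
      then show ?thesis by simp
    qed
    then obtain h where h: "\<And>c. c \<in> C \<Longrightarrow> h c \<in> F \<and> dist (h c) (S c) < sqrt \<mu> / 2" by metis
    have "inj_on h C"
    proof (rule inj_onI, rule ccontr)
      fix c c' assume c: "c \<in> C" "c' \<in> C" "h c = h c'" "c \<noteq> c'"
      have "dist (S c) (S c') < sqrt \<mu> / 2 + sqrt \<mu> / 2"
        using h[OF c(1)] h[OF c(2)] c(3) by (metis dist_commute dist_triangle_less_add)
      then have "norm (S c - S c') < sqrt \<mu>" by (simp add: dist_norm)
      then have "(norm (S c - S c'))\<^sup>2 < \<mu>"
        using assms(2) by (metis less_eq_real_def norm_ge_zero power_strict_mono real_sqrt_pow2 zero_less_numeral)
      moreover have "(norm (S c - S c'))\<^sup>2 = (norm (S c))\<^sup>2 + (norm (S c'))\<^sup>2"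
      proof -
        have "inner (S c) (S c') = 0" using C(3) c by (auto simp: pairwise_def)
        then show ?thesis unfolding power2_norm_eq_inner by (simp add: inner_diff inner_commute)
      qed
      ultimately show False using C(2)[OF c(1)] C(2)[OF c(2)] assms(2) by linarith
    qed
    then show "card C \<le> card F" using h F(1) by (intro card_inj_on_le[of h]) auto
  qed
qed

text \<open>The vectors \<open>e m\<close> with \<open>lam m = 0\<close> are 0, so that the index set is always the naturals.\<close>

locale singular_system =
  fixes S :: "'a::{real_inner,complete_space} \<Rightarrow> 'b::{real_inner,complete_space}"
    and lam :: "nat \<Rightarrow> real" and e :: "nat \<Rightarrow> 'a"
  assumes decseq: "decseq lam" and nonneg: "0 \<le> lam m" and lim: "lam \<longlonglongrightarrow> 0"
    and orthonormal: "inner (e i) (e j) = (if i = j \<and> lam i > 0 then 1 else 0)"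
    and singular: "inner (S (e i)) (S x) = lam i * inner (e i) x"
    and norm_sums: "(\<lambda>m. lam m * (inner (e m) x)\<^sup>2) sums (norm (S x))\<^sup>2"

section \<open>Spectral theorem for the operator \<open>adjoint S \<circ> S\<close>\<close>

lemma bounded_linear_adjoint:
  fixes S :: "'a::{real_inner,complete_space} \<Rightarrow> 'b::real_inner"
  assumes "bounded_linear S"
  shows "bounded_linear (adjoint S)"
proof -
  note adj = inner_adjoint[OF assms]
  obtain K where K: "\<And>x. norm (S x) \<le> norm x * K" "0 \<le> K"
    using bounded_linear.nonneg_bounded[OF assms] by metis
  show ?thesis
  proof (rule bounded_linear_intro)
    show "adjoint S (x + y) = adjoint S x + adjoint S y" for x y
      by (rule vector_eq_ldot[THEN iffD1]) (simp add: adj inner_add_right)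
    show "adjoint S (r *\<^sub>R x) = r *\<^sub>R adjoint S x" for r x
      by (rule vector_eq_ldot[THEN iffD1]) (simp add: adj)
    show "norm (adjoint S y) \<le> norm y * K" for y
    proof (cases "adjoint S y = 0")
      case False
      have "norm (adjoint S y) * norm (adjoint S y) = inner (S (adjoint S y)) y"
        by (simp flip: adj add: norm_eq_sqrt_inner)
      also have "\<dots> \<le> norm (S (adjoint S y)) * norm y" by (rule norm_cauchy_schwarz)
      also have "\<dots> \<le> norm (adjoint S y) * K * norm y" by (intro mult_right_mono K) simp
      finally show ?thesis using False by (simp add: mult.assoc mult.commute)
    qed (use K in simp)
  qed
qed

text \<open>A sequence maximizing \<open>norm (S x)\<close> over the unit ball of \<open>V\<close> has a subsequence converging to an
  eigenvector for the eigenvalue \<open>s\<^sup>2\<close>, where \<open>s\<close> is the supremum.\<close>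

lemma compact_operator_eigenvector:
  fixes S :: "'a::{real_inner,complete_space} \<Rightarrow> 'b::{real_inner,complete_space}"
  assumes S: "compact_operator S" and V: "subspace V" "closed V"
    and inv: "\<And>x. x \<in> V \<Longrightarrow> adjoint S (S x) \<in> V"
    and nz: "v \<in> V" "S v \<noteq> 0"
  obtains \<mu> x where "\<mu> > 0" "x \<in> V" "x \<noteq> 0" "adjoint S (S x) = \<mu> *\<^sub>R x"
proof -
  have blS: "bounded_linear S" using S by (simp add: compact_operator_def)
  interpret S: bounded_linear S by fact
  interpret A: bounded_linear "adjoint S" using bounded_linear_adjoint[OF blS] .
  note adj = inner_adjoint[OF blS]
  define R where "R = (\<lambda>x. norm (S x)) ` {x \<in> V. norm x \<le> 1}"
  obtain K where K: "\<And>x. norm (S x) \<le> norm x * K" "0 \<le> K" using S.nonneg_bounded by metis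
  have bdd: "bdd_above R"
  proof (rule bdd_aboveI)
    fix r assume "r \<in> R"
    then obtain x where "norm x \<le> 1" "r = norm (S x)" by (auto simp: R_def)
    then show "r \<le> K" using K(1)[of x] mult_right_mono[of "norm x" 1 K] K(2) by simp
  qed
  define s where "s = Sup R"
  have le: "norm (S x) \<le> s" if "x \<in> V" "norm x \<le> 1" for x
    unfolding s_def by (rule cSup_upper[OF _ bdd]) (use that in \<open>simp add: R_def\<close>)
  have le': "norm (S x) \<le> s * norm x" if "x \<in> V" for x
  proof (cases "x = 0")
    case False
    have "norm (S ((1 / norm x) *\<^sub>R x)) \<le> s"
      by (rule le) (use False subspace_scale[OF V(1) that] in auto)
    then show ?thesis using False by (simp add: S.scaleR field_simps)
  qed (simp add: S.zero)
  have "v \<noteq> 0" using nz(2) by (auto simp: S.zero)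
  have spos: "s > 0"
  proof -
    have "0 < s * norm v" using le'[OF nz(1)] nz(2) by (meson less_le_trans zero_less_norm_iff)
    then show ?thesis using \<open>v \<noteq> 0\<close> by (simp add: zero_less_mult_iff)
  qed
  have "\<exists>x\<in>V. norm x \<le> 1 \<and> s - 1 / real (Suc n) < norm (S x)" for n
  proof -
    have "norm (S 0) \<in> R" unfolding R_def by (intro imageI) (simp add: subspace_0[OF V(1)])
    then have "R \<noteq> {}" by blast
    moreover have "s - 1 / real (Suc n) < Sup R" by (simp add: s_def)
    ultimately obtain y where "y \<in> R" "s - 1 / real (Suc n) < y" using less_cSupD by metis
    then show ?thesis unfolding R_def by blast
  qed
  then obtain X where X: "\<And>n. X n \<in> V" "\<And>n. norm (X n) \<le> 1"
    "\<And>n. s - 1 / real (Suc n) < norm (S (X n))" by metis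
  have s_lim: "(\<lambda>n. s - 1 / real (Suc n)) \<longlonglongrightarrow> s"
    using tendsto_diff[OF tendsto_const[of s] LIMSEQ_Suc[OF lim_1_over_n]] by simp
  have normSX: "(\<lambda>n. norm (S (X n))) \<longlonglongrightarrow> s"
  proof (rule real_tendsto_sandwich[OF _ _ s_lim tendsto_const])
    show "\<forall>\<^sub>F n in sequentially. s - 1 / real (Suc n) \<le> norm (S (X n))"
      using X(3) by (intro always_eventually allI less_imp_le)
    show "\<forall>\<^sub>F n in sequentially. norm (S (X n)) \<le> s"
      using X(1,2) by (intro always_eventually allI le)
  qed
  have "\<forall>n. S (X n) \<in> closure (S ` cball 0 1)"
    using X(2) by (intro allI subsetD[OF closure_subset] imageI) simp
  moreover have "seq_compact (closure (S ` cball 0 1))"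
    using S by (simp add: compact_operator_def compact_imp_seq_compact)
  ultimately obtain y r where r: "strict_mono r" "((\<lambda>n. S (X n)) \<circ> r) \<longlonglongrightarrow> y"
    using seq_compactE by metis
  define z where "z = adjoint S y"
  have SX: "(\<lambda>n. S (X (r n))) \<longlonglongrightarrow> y" using r(2) by (simp add: o_def)
  then have WX: "(\<lambda>n. adjoint S (S (X (r n)))) \<longlonglongrightarrow> z" unfolding z_def by (rule A.tendsto)
  have normSXr: "(\<lambda>n. norm (S (X (r n)))) \<longlonglongrightarrow> s"
    using LIMSEQ_subseq_LIMSEQ[OF normSX r(1)] by (simp add: o_def)
  \<comment> \<open>Expand the square. Invariance of \<open>V\<close> allows the bound
    \<open>norm (S w) \<le> s * norm w\<close> for \<open>w = adjoint S (S x)\<close>, hence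
    \<open>norm w \<le> s * norm (S x)\<close>. Along a maximizing sequence the right-hand side
    tends to \<open>s^4 - s^2 * s^2 = 0\<close>.\<close>
  have ineq: "(norm (adjoint S (S x) - s\<^sup>2 *\<^sub>R x))\<^sup>2 \<le> s ^ 4 - s\<^sup>2 * (norm (S x))\<^sup>2"
    if x: "x \<in> V" "norm x \<le> 1" for x
  proof -
    let ?w = "adjoint S (S x)"
    have "norm ?w \<le> s * norm (S x)"
    proof (cases "?w = 0")
      case False
      have "norm ?w * norm ?w = inner (S ?w) (S x)" by (simp flip: adj add: norm_eq_sqrt_inner)
      also have "\<dots> \<le> norm (S ?w) * norm (S x)" by (rule norm_cauchy_schwarz)
      also have "\<dots> \<le> s * norm ?w * norm (S x)" by (intro mult_right_mono le' inv x) simp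
      finally show ?thesis using False by (simp add: mult.assoc mult.left_commute)
    qed (use spos in simp)
    then have w: "(norm ?w)\<^sup>2 \<le> s\<^sup>2 * (norm (S x))\<^sup>2"
      by (metis norm_ge_zero power_mono power_mult_distrib)
    have wx: "inner ?w x = (norm (S x))\<^sup>2" by (simp add: inner_commute adj power2_norm_eq_inner)
    have "(norm (?w - s\<^sup>2 *\<^sub>R x))\<^sup>2 = (norm ?w)\<^sup>2 + s ^ 4 * (norm x)\<^sup>2 - 2 * s\<^sup>2 * inner ?w x"
      unfolding power2_norm_eq_inner
      by (simp add: inner_diff inner_commute power2_eq_square power4_eq_xxxx)
    moreover have "s ^ 4 * (norm x)\<^sup>2 \<le> s ^ 4 * 1"
      using x(2) by (intro mult_left_mono power_le_one) auto
    ultimately show ?thesis using w wx by simp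
  qed
  have "(\<lambda>n. adjoint S (S (X (r n))) - s\<^sup>2 *\<^sub>R X (r n)) \<longlonglongrightarrow> 0"
  proof -
    have "(\<lambda>n. s ^ 4 - s\<^sup>2 * (norm (S (X (r n))))\<^sup>2) \<longlonglongrightarrow> s ^ 4 - s\<^sup>2 * s\<^sup>2"
      by (intro tendsto_intros normSXr)
    then have "(\<lambda>n. s ^ 4 - s\<^sup>2 * (norm (S (X (r n))))\<^sup>2) \<longlonglongrightarrow> 0" by (simp add: power4_eq_xxxx power2_eq_square)
    then have "(\<lambda>n. (norm (adjoint S (S (X (r n))) - s\<^sup>2 *\<^sub>R X (r n)))\<^sup>2) \<longlonglongrightarrow> 0"
      by (rule real_tendsto_sandwich[OF _ _ tendsto_const, rotated 2])
        (intro always_eventually allI ineq X zero_le_power2)+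
    from tendsto_real_sqrt[OF this]
    have "(\<lambda>n. norm (adjoint S (S (X (r n))) - s\<^sup>2 *\<^sub>R X (r n))) \<longlonglongrightarrow> 0" by simp
    then show ?thesis by (rule tendsto_norm_zero_cancel)
  qed
  \<comment> \<open>Compactness makes only the images converge. As \<open>X (r n)\<close> is
    asymptotically an eigenvector for the nonzero number \<open>s^2\<close>, the vectors themselves
    then converge as well.\<close>
  from tendsto_diff[OF WX this] have "(\<lambda>n. s\<^sup>2 *\<^sub>R X (r n)) \<longlonglongrightarrow> z" by simp
  from tendsto_scaleR[OF tendsto_const[of "1 / s\<^sup>2"] this]
  have Xlim: "(\<lambda>n. X (r n)) \<longlonglongrightarrow> (1 / s\<^sup>2) *\<^sub>R z" (is "_ \<longlonglongrightarrow> ?x") using spos by simp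
  have "?x \<in> V" using closed_sequentially[OF V(2) _ Xlim] X(1) by blast
  moreover have "norm (S ?x) = s"
    using LIMSEQ_unique[OF tendsto_norm[OF S.tendsto[OF Xlim]] normSXr] .
  then have "?x \<noteq> 0" using spos by (metis S.zero norm_zero less_irrefl)
  moreover have "adjoint S (S ?x) = s\<^sup>2 *\<^sub>R ?x"
    using LIMSEQ_unique[OF A.tendsto[OF S.tendsto[OF Xlim]] WX] spos by simp
  ultimately show ?thesis using that[of "s\<^sup>2" ?x] spos by simp
qed

text \<open>For a space with an infinite basis \<open>dim\<close> is 0 by convention, so finiteness
  has to be established before \<open>dim E\<close> is the multiplicity. An infinite independent set
  would yield orthonormal families in \<open>E\<close> of every size, with orthogonal images of
  squared norm \<mu>, against compactness.\<close>

lemma eigenspace_orthonormal_basis: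
  fixes S :: "'a::{real_inner,complete_space} \<Rightarrow> 'b::{real_inner,complete_space}"
  assumes S: "compact_operator S" and \<mu>: "\<mu> > 0"
  defines "E \<equiv> {x. adjoint S (S x) = \<mu> *\<^sub>R x}"
  obtains C where "finite C" "pairwise orthogonal C" "\<And>c. c \<in> C \<Longrightarrow> norm c = 1" "span C = E" "card C = dim E"
proof -
  have blS: "bounded_linear S" using S by (simp add: compact_operator_def)
  interpret S: bounded_linear S by fact
  interpret A: bounded_linear "adjoint S" using bounded_linear_adjoint[OF blS] .
  have subE: "subspace E"
    by (rule subspaceI) (auto simp: E_def S.add A.add S.scaleR A.scaleR S.zero A.zero scaleR_add_right)
  have inner_E: "inner (S x) (S y) = \<mu> * inner x y" if "x \<in> E" for x y
    using inner_adjoint[OF blS, of y "S x"] that by (simp add: E_def inner_commute)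
  obtain k where k: "\<And>C. finite C \<Longrightarrow> (\<And>c. c \<in> C \<Longrightarrow> norm c \<le> 1 \<and> \<mu> \<le> (norm (S c))\<^sup>2) \<Longrightarrow>
    pairwise (\<lambda>x y. inner (S x) (S y) = 0) C \<Longrightarrow> card C \<le> k"
    using compact_operator_orthogonal_bounded[OF S \<mu>] by metis
  have card_orth: "card C \<le> k"
    if "finite C" "pairwise orthogonal C" "\<And>c. c \<in> C \<Longrightarrow> norm c = 1" "C \<subseteq> E" for C
  proof (rule k[OF that(1)])
    show "norm c \<le> 1 \<and> \<mu> \<le> (norm (S c))\<^sup>2" if "c \<in> C" for c
    proof -
      have c: "norm c = 1" "c \<in> E" using \<open>C \<subseteq> E\<close> \<open>\<And>c. c \<in> C \<Longrightarrow> norm c = 1\<close>[OF that] that by auto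
      then have "(norm (S c))\<^sup>2 = \<mu>" using inner_E[OF c(2), of c] by (simp add: power2_norm_eq_inner norm_eq_1)
      then show ?thesis using c(1) by simp
    qed
    show "pairwise (\<lambda>x y. inner (S x) (S y) = 0) C"
      using that(2,4) by (auto simp: pairwise_def orthogonal_def inner_E subsetD)
  qed
  have indep: "independent C" if "pairwise orthogonal C" "\<And>c. c \<in> C \<Longrightarrow> norm c = 1" for C :: "'a set"
    by (rule pairwise_orthogonal_independent[OF that(1)]) (use that(2) in force)
  obtain B where B: "B \<subseteq> E" "independent B" "E \<subseteq> span B" "card B = dim E" by (rule basis_exists)
  have "finite B"
  proof (rule ccontr)
    assume "infinite B"
    then obtain F where F: "finite F" "card F = Suc k" "F \<subseteq> B" using infinite_arbitrarily_large by metis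
    obtain C where C: "finite C" "pairwise orthogonal C" "\<And>c. c \<in> C \<Longrightarrow> norm c = 1" "span C = span F"
      using orthonormal_basis_of_span[OF F(1)] by metis
    have "F \<subseteq> E" using F(3) B(1) by (rule subset_trans)
    then have "C \<subseteq> E" using C(4) span_superset[of C] span_minimal[OF _ subE, of F] by blast
    moreover have "card C = Suc k"
      using indep[OF C(2,3)] independent_mono[OF B(2) F(3)] C(4) F(2)
      by (metis dim_span_eq_card_independent)
    ultimately show False using card_orth[OF C(1-3)] by simp
  qed
  then obtain C where C: "finite C" "pairwise orthogonal C" "\<And>c. c \<in> C \<Longrightarrow> norm c = 1" "span C = span B"
    using orthonormal_basis_of_span by metis
  have "span B = E" using B(1,3) span_minimal[OF _ subE] by blast
  then show ?thesis
    using that[OF C(1-3)] C(4) B(4) dim_span_eq_card_independent[OF indep[OF C(2,3)]]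
      dim_span_eq_card_independent[OF B(2)] by simp
qed

text \<open>For each \<mu> > 0 there are as many indices \<open>m\<close> with
  \<open>lam m = \<mu>\<close> as vectors in an orthonormal basis of the eigenspace; a bijection
  \<open>h \<mu>\<close> distributes the basis over these indices. Orthonormality and the singular
  value relation are then direct; decay and completeness rest on compactness.\<close>

lemma singular_system_exists:
  fixes S :: "'a::{real_inner,complete_space} \<Rightarrow> 'b::{real_inner,complete_space}"
  assumes S: "compact_operator S" and lam: "eigenvalue_seq (adjoint S \<circ> S) lam"
  obtains e where "singular_system S lam e"
proof -
  have blS: "bounded_linear S" using S by (simp add: compact_operator_def)
  interpret S: bounded_linear S by fact
  interpret A: bounded_linear "adjoint S" using bounded_linear_adjoint[OF blS] .
  note adj = inner_adjoint[OF blS]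
  have dec: "decseq lam" and nonneg: "\<And>m. 0 \<le> lam m"
    and fin: "\<And>\<mu>. \<mu> > 0 \<Longrightarrow> finite {m. lam m = \<mu>}"
    and card: "\<And>\<mu>. \<mu> > 0 \<Longrightarrow> card {m. lam m = \<mu>} = dim {x. adjoint S (S x) = \<mu> *\<^sub>R x}"
    using lam by (auto simp: eigenvalue_seq_def)
  define basis where "basis \<mu> C h \<longleftrightarrow> bij_betw h {m. lam m = \<mu>} C \<and> pairwise orthogonal C \<and>
    (\<forall>c\<in>C. norm c = 1) \<and> span C = {x. adjoint S (S x) = \<mu> *\<^sub>R x}" for \<mu> :: real and C h
  have "\<exists>C h. basis \<mu> C h" if \<mu>: "\<mu> > 0" for \<mu>
  proof -
    obtain C where C: "finite C" "pairwise orthogonal C" "\<And>c. c \<in> C \<Longrightarrow> norm c = 1"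
      "span C = {x. adjoint S (S x) = \<mu> *\<^sub>R x}" "card C = dim {x. adjoint S (S x) = \<mu> *\<^sub>R x}"
      using eigenspace_orthonormal_basis[OF S \<mu>] by metis
    then obtain h where "bij_betw h {m. lam m = \<mu>} C"
      using finite_same_card_bij[OF fin[OF \<mu>] C(1)] card[OF \<mu>] by metis
    then show ?thesis unfolding basis_def using C(2-4) by (intro exI[of _ C] exI[of _ h]) simp
  qed
  then obtain C h where "\<And>\<mu>. \<mu> > 0 \<Longrightarrow> basis \<mu> (C \<mu>) (h \<mu>)" by metis
  then have h: "\<And>\<mu>. \<mu> > 0 \<Longrightarrow> bij_betw (h \<mu>) {m. lam m = \<mu>} (C \<mu>)"
    and orth: "\<And>\<mu>. \<mu> > 0 \<Longrightarrow> pairwise orthogonal (C \<mu>)"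
    and norm1: "\<And>\<mu> c. \<mu> > 0 \<Longrightarrow> c \<in> C \<mu> \<Longrightarrow> norm c = 1"
    and span: "\<And>\<mu>. \<mu> > 0 \<Longrightarrow> span (C \<mu>) = {x. adjoint S (S x) = \<mu> *\<^sub>R x}"
    by (simp_all add: basis_def)
  define e where "e m = (if lam m > 0 then h (lam m) m else 0)" for m
  have e_in: "e m \<in> C (lam m)" if "lam m > 0" for m
    using bij_betwE[OF h[OF that]] that by (simp add: e_def)
  have eig: "adjoint S (S (e m)) = lam m *\<^sub>R e m" for m
  proof (cases "lam m > 0")
    case True
    have "e m \<in> {x. adjoint S (S x) = lam m *\<^sub>R x}"
      using span_base[OF e_in[OF True]] by (simp only: span[OF True])
    then show ?thesis by simp
  next
    case False
    then show ?thesis by (simp add: e_def S.zero A.zero)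
  qed
  have sing: "inner (S (e i)) (S x) = lam i * inner (e i) x" for i x
    using adj[of x "S (e i)"] eig[of i] by (simp add: inner_commute)
  have orthonormal: "inner (e i) (e j) = (if i = j \<and> lam i > 0 then 1 else 0)" for i j
  proof (cases "lam i > 0 \<and> lam j > 0")
    case True
    show ?thesis
    proof (cases "lam i = lam j")
      case eq: True
      show ?thesis
      proof (cases "i = j")
        case True
        then show ?thesis using norm1[OF _ e_in, of i] \<open>lam i > 0 \<and> lam j > 0\<close> by (simp add: norm_eq_1)
      next
        case False
        have "inj_on (h (lam i)) {m. lam m = lam i}" using h[of "lam i"] True by (simp add: bij_betw_def)
        then have "e i \<noteq> e j" using False True eq by (auto simp: e_def dest: inj_onD)
        then show ?thesis using orth[of "lam i"] e_in[of i] e_in[of j] True eq False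
          by (auto simp: pairwise_def orthogonal_def)
      qed
    next
      case False
      \<comment> \<open>Both sides equal \<open>inner (S (e i)) (S (e j))\<close>, so eigenvectors
        for different eigenvalues are orthogonal.\<close>
      have "lam i * inner (e i) (e j) = lam j * inner (e i) (e j)"
        using sing[of i "e j"] sing[of j "e i"] by (simp add: inner_commute)
      then show ?thesis using False by auto
    qed
  qed (use nonneg in \<open>auto simp: e_def\<close>)
  have lim: "lam \<longlonglongrightarrow> 0"
  proof -
    obtain L where L: "lam \<longlonglongrightarrow> L" "\<And>m. L \<le> lam m"
      using decseq_convergent[OF dec, of 0] nonneg by metis
    have "L \<le> 0"
    proof (rule ccontr)
      assume "\<not> L \<le> 0"
      then have pos: "lam m > 0" for m using L(2)[of m] by linarith
      \<comment> \<open>With a positive limit \<open>L\<close>, all \<open>e m\<close> would be unit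
        vectors with orthogonal images of squared norm at least \<open>L\<close>; the
        \<open>k + 1\<close> vectors \<open>e 0, ..., e k\<close> already exceed the bound
        \<open>k\<close>.\<close>
      obtain k where k: "\<And>C. finite C \<Longrightarrow> (\<And>c. c \<in> C \<Longrightarrow> norm c \<le> 1 \<and> L \<le> (norm (S c))\<^sup>2) \<Longrightarrow>
        pairwise (\<lambda>x y. inner (S x) (S y) = 0) C \<Longrightarrow> card C \<le> k"
        using compact_operator_orthogonal_bounded[OF S, of L] \<open>\<not> L \<le> 0\<close> by (metis not_le)
      have "card (e ` {..k}) \<le> k"
      proof (rule k)
        show "norm c \<le> 1 \<and> L \<le> (norm (S c))\<^sup>2" if "c \<in> e ` {..k}" for c
          using that sing orthonormal pos L(2) by (auto simp: power2_norm_eq_inner norm_eq_sqrt_inner)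
        show "pairwise (\<lambda>x y. inner (S x) (S y) = 0) (e ` {..k})"
          using sing orthonormal by (auto simp: pairwise_def)
      qed simp
      moreover have "inj e"
      proof (rule injI)
        fix i j assume "e i = e j"
        then show "i = j" using orthonormal[of i j] orthonormal[of i i] pos[of i] by (simp split: if_splits)
      qed
      then have "card (e ` {..k}) = Suc k" by (simp add: card_image inj_on_subset)
      ultimately show False by simp
    qed
    moreover have "L \<ge> 0" using L(1) nonneg by (meson LIMSEQ_le_const)
    ultimately show ?thesis using L(1) by simp
  qed
  have kernel: "S x = 0" if x: "\<And>m. inner (e m) x = 0" for x
  proof (rule ccontr)
    assume nz: "S x \<noteq> 0"
    \<comment> \<open>The orthogonal complement of all \<open>e m\<close> is closed and invariant.
      If \<open>S\<close> did not vanish on it, it would contain an eigenvector for some \<mu> > 0,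
      which also lies in an eigenspace spanned by some of the \<open>e m\<close> and is thus
      orthogonal to itself.\<close>
    define V where "V = {x. \<forall>m. inner (e m) x = 0}"
    have "subspace V" by (rule subspaceI) (auto simp: V_def inner_add_right)
    moreover have "closed V" unfolding V_def by (intro closed_Collect_all closed_Collect_eq continuous_intros)
    moreover have "adjoint S (S y) \<in> V" if "y \<in> V" for y
      using that by (simp add: V_def adj sing)
    moreover have "x \<in> V" using x by (simp add: V_def)
    ultimately obtain \<mu> y where y: "\<mu> > 0" "y \<in> V" "y \<noteq> 0" "adjoint S (S y) = \<mu> *\<^sub>R y"
      using compact_operator_eigenvector[OF S _ _ _ _ nz] by metis
    have "y \<in> span (C \<mu>)" using span[OF y(1)] y(4) by simp
    moreover have "inner c y = 0" if c: "c \<in> C \<mu>" for c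
    proof -
      obtain m where "lam m = \<mu>" "h \<mu> m = c"
        using c unfolding bij_betw_imp_surj_on[OF h[OF y(1)], symmetric] by auto
      then show ?thesis using y(1,2) by (auto simp: V_def e_def dest: spec[of _ m])
    qed
    ultimately have "inner y y = 0"
      using orthogonal_to_span[of y "C \<mu>" y] by (simp add: orthogonal_def inner_commute)
    then show False using y(3) by simp
  qed
  have sums: "(\<lambda>m. lam m * (inner (e m) x)\<^sup>2) sums (norm (S x))\<^sup>2" for x
  proof -
    \<comment> \<open>The \<open>e m\<close> need not span a dense subspace, since the kernel of
      \<open>S\<close> may be large. The limit \<open>p\<close> of these projections differs from
      \<open>x\<close> by a vector orthogonal to every \<open>e m\<close>, which \<open>S\<close>
      annihilates; hence \<open>S x = S p\<close>.\<close>
    define P where "P N = (\<Sum>m<N. inner x (e m) *\<^sub>R e m)" for N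
    have e01: "e m = 0 \<or> norm (e m) = 1" for m
      using orthonormal[of m m] by (auto simp: norm_eq_1 split: if_splits)
    have "convergent P" unfolding P_def
    proof (rule orthogonal_series_convergent)
      show "mono (\<lambda>N. {..<N::nat})" by (rule monoI) simp
      fix N
      have "(\<Sum>m<N. (norm (inner x (e m) *\<^sub>R e m))\<^sup>2) \<le> (\<Sum>m<N. (inner x (e m))\<^sup>2)"
      proof (rule sum_mono)
        fix m show "(norm (inner x (e m) *\<^sub>R e m))\<^sup>2 \<le> (inner x (e m))\<^sup>2" using e01[of m] by auto
      qed
      also have "\<dots> \<le> (norm x)\<^sup>2"
        by (rule Bessel_inequality) (use orthonormal e01 in auto)
      finally show "(\<Sum>m<N. (norm (inner x (e m) *\<^sub>R e m))\<^sup>2) \<le> (norm x)\<^sup>2" .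
    qed (use orthonormal in auto)
    then obtain p where p: "P \<longlonglongrightarrow> p" by (auto simp: convergent_def)
    have inner_P: "inner (e m) (P N) = (if m < N then inner (e m) x else 0)" for m N
    proof -
      have "inner (e m) (P N) = (\<Sum>i<N. if i = m then inner (e m) x else 0)"
        unfolding P_def inner_sum_right
        by (rule sum.cong) (use orthonormal nonneg[of m] in \<open>auto simp: inner_commute e_def\<close>)
      then show ?thesis by (simp add: sum.delta)
    qed
    have "inner (e m) (x - p) = 0" for m
    proof -
      have "(\<lambda>N. inner (e m) (P N)) \<longlonglongrightarrow> inner (e m) p" by (intro tendsto_intros p)
      moreover have "\<forall>\<^sub>F N in sequentially. inner (e m) (P N) = inner (e m) x"
        using eventually_gt_at_top[of m] by eventually_elim (simp add: inner_P)
      ultimately have "inner (e m) p = inner (e m) x"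
        by (metis LIMSEQ_unique tendsto_eventually)
      then show ?thesis by (simp add: inner_diff_right)
    qed
    then have "S x = S p" using kernel[of "x - p"] by (simp add: S.diff)
    then have "(\<lambda>N. (norm (S (P N)))\<^sup>2) \<longlonglongrightarrow> (norm (S x))\<^sup>2"
      by (simp add: tendsto_intros S.tendsto[OF p])
    moreover have "(norm (S (P N)))\<^sup>2 = (\<Sum>m<N. lam m * (inner (e m) x)\<^sup>2)" for N
    proof -
      have "S (P N) = (\<Sum>m<N. inner x (e m) *\<^sub>R S (e m))" by (simp add: P_def S.sum S.scaleR)
      then have "(norm (S (P N)))\<^sup>2 = (\<Sum>m<N. (inner x (e m))\<^sup>2 * (norm (S (e m)))\<^sup>2)"
        using sing orthonormal by (simp only:) (rule norm_sum_orthogonal, auto)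
      also have "\<dots> = (\<Sum>m<N. lam m * (inner (e m) x)\<^sup>2)"
      proof (rule sum.cong)
        fix m
        show "(inner x (e m))\<^sup>2 * (norm (S (e m)))\<^sup>2 = lam m * (inner (e m) x)\<^sup>2"
          using sing[of m "e m"] orthonormal[of m m] nonneg[of m]
          by (auto simp: power2_norm_eq_inner inner_commute e_def)
      qed simp
      finally show ?thesis .
    qed
    ultimately show ?thesis by (simp add: sums_def)
  qed
  have "singular_system S lam e"
    by unfold_locales (use dec nonneg lim orthonormal sing sums in auto)
  then show ?thesis by (rule that)
qed

section \<open>Tensor powers of the operator\<close>

declare One_nat_def [simp del]

text \<open>Extensional functions represent each multi-index exactly once, so that cardinalities are
  the intended ones. Exhausting by cubes lets sums of products factor into products of sums over
  single coordinates.\<close>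

abbreviation cube :: "nat \<Rightarrow> nat \<Rightarrow> (nat \<Rightarrow> nat) set" where
  "cube d N \<equiv> {1..d} \<rightarrow>\<^sub>E {..<N}"

abbreviation multi_indices :: "nat \<Rightarrow> (nat \<Rightarrow> nat) set" where
  "multi_indices d \<equiv> {1..d} \<rightarrow>\<^sub>E UNIV"

lemma cube_mono: "M \<le> N \<Longrightarrow> cube d M \<subseteq> cube d N"
  by (rule PiE_mono) auto

lemma finite_multi_indices_cube:
  assumes "finite K" "K \<subseteq> multi_indices d"
  obtains N where "K \<subseteq> cube d N"
proof -
  have "finite (\<Union>k\<in>K. k ` {1..d})" using assms(1) by simp
  then obtain N where N: "\<And>m. m \<in> (\<Union>k\<in>K. k ` {1..d}) \<Longrightarrow> m < N"
    by (meson finite_nat_set_iff_bounded)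
  have "K \<subseteq> cube d N"
  proof
    fix k assume k: "k \<in> K"
    then have "k \<in> extensional {1..d}" using assms(2) by (auto simp: PiE_def)
    moreover have "k i < N" if "i \<in> {1..d}" for i by (rule N) (use k that in blast)
    ultimately show "k \<in> cube d N" by (simp add: PiE_def Pi_def)
  qed
  then show ?thesis by (rule that)
qed

lemma prod_delta_multi_indices:
  fixes c :: "nat \<Rightarrow> 'c::{comm_semiring_1}"
  assumes "k \<in> multi_indices d" "l \<in> multi_indices d"
  shows "(\<Prod>i=1..d. if k i = l i then c (k i) else 0) = (if k = l then \<Prod>i=1..d. c (k i) else 0)"
proof (cases "k = l")
  case False
  then obtain i where "i \<in> {1..d}" "k i \<noteq> l i" using PiE_ext[OF assms] by blast
  then have "(\<Prod>i=1..d. if k i = l i then c (k i) else 0) = 0" by (intro prod_zero) auto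
  then show ?thesis using False by simp
qed simp

lemma tensor_realization_inner:
  "tensor_realization t \<Longrightarrow> d \<ge> 1 \<Longrightarrow> inner (t d f) (t d g) = (\<Prod>i=1..d. inner (f i) (g i))"
  by (simp add: tensor_realization_def)

locale tensor_problem = singular_system S lam e
  for S :: "'a::{real_inner,complete_space} \<Rightarrow> 'b::{real_inner,complete_space}" and lam e +
  fixes t :: "nat \<Rightarrow> (nat \<Rightarrow> 'a) \<Rightarrow> 'h::{real_inner,complete_space}"
    and u :: "nat \<Rightarrow> (nat \<Rightarrow> 'b) \<Rightarrow> 'k::{real_inner,complete_space}"
    and d :: nat
  assumes realization_t: "tensor_realization t" and realization_u: "tensor_realization u" and d: "d \<ge> 1"
begin

definition left where "left k = t d (\<lambda>i. e (k i))"
text \<open>The image of \<open>left k\<close> under the tensor power of \<open>S\<close>, not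
  normalized: its squared norm is \<open>ev k\<close>, so singular values equal to 0 cause no
  division.\<close>

definition right where "right k = u d (\<lambda>i. S (e (k i)))"
definition ev where "ev k = (\<Prod>i=1..d. lam (k i))"

lemma ev_le: "ev k \<le> lam 0 ^ d"
  using prod_mono[of "{1..d}" "\<lambda>i. lam (k i)" "\<lambda>_. lam 0"] nonneg decseqD[OF decseq, of 0]
  by (simp add: ev_def)

lemma inner_left:
  assumes "k \<in> multi_indices d" "l \<in> multi_indices d"
  shows "inner (left k) (left l) = (if k = l \<and> ev k > 0 then 1 else 0)"
proof -
  have "inner (left k) (left l) = (\<Prod>i=1..d. if k i = l i then (if lam (k i) > 0 then 1 else 0) else 0)"
    by (auto simp: left_def tensor_realization_inner[OF realization_t d] orthonormal intro: prod.cong)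
  also have "\<dots> = (if k = l then \<Prod>i=1..d. (if lam (k i) > 0 then 1 else 0) else 0)"
    by (rule prod_delta_multi_indices[OF assms])
  also have "(\<Prod>i=1..d. (if lam (k i) > 0 then 1 else 0)) = (if ev k > 0 then 1 else (0::real))"
  proof (cases "\<forall>i\<in>{1..d}. lam (k i) > 0")
    case True
    then show ?thesis unfolding ev_def by (auto intro!: prod_pos)
  next
    case False
    then obtain i where i: "i \<in> {1..d}" "lam (k i) = 0" using nonneg by (metis less_eq_real_def)
    then have "ev k = 0" unfolding ev_def by (intro prod_zero) auto
    moreover have "(\<Prod>i=1..d. (if lam (k i) > 0 then 1 else 0)) = (0::real)"
      using i by (intro prod_zero) (auto intro!: bexI[of _ i])
    ultimately show ?thesis by simp
  qed
  finally show ?thesis by simp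
qed

lemma left_cases: "k \<in> multi_indices d \<Longrightarrow> left k = 0 \<or> norm (left k) = 1"
  using inner_left[of k k] by (auto simp: norm_eq_1 split: if_splits)

lemma inner_right:
  assumes "k \<in> multi_indices d" "l \<in> multi_indices d"
  shows "inner (right k) (right l) = (if k = l then ev k else 0)"
proof -
  have "inner (right k) (right l) = (\<Prod>i=1..d. if k i = l i then lam (k i) else 0)"
    unfolding right_def tensor_realization_inner[OF realization_u d]
    by (rule prod.cong) (use nonneg in \<open>auto simp: singular orthonormal less_le\<close>)
  also have "\<dots> = (if k = l then ev k else 0)"
    unfolding ev_def by (rule prod_delta_multi_indices[OF assms])
  finally show ?thesis .
qed

lemma norm_right: "k \<in> multi_indices d \<Longrightarrow> (norm (right k))\<^sup>2 = ev k"
  by (simp add: power2_norm_eq_inner inner_right)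

lemma Bessel_left:
  "finite A \<Longrightarrow> A \<subseteq> multi_indices d \<Longrightarrow> (\<Sum>k\<in>A. (inner x (left k))\<^sup>2) \<le> (norm x)\<^sup>2"
  by (rule Bessel_inequality) (auto simp: inner_left left_cases subset_iff)

lemma norm_expansion:
  assumes "finite A" "A \<subseteq> multi_indices d"
  shows "(norm (\<Sum>k\<in>A. inner x (left k) *\<^sub>R right k))\<^sup>2 = (\<Sum>k\<in>A. (inner x (left k))\<^sup>2 * ev k)"
proof -
  have "(norm (\<Sum>k\<in>A. inner x (left k) *\<^sub>R right k))\<^sup>2 = (\<Sum>k\<in>A. (inner x (left k))\<^sup>2 * (norm (right k))\<^sup>2)"
    by (rule norm_sum_orthogonal) (use assms in \<open>auto simp: inner_right subset_iff\<close>)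
  then show ?thesis using assms(2) by (simp add: norm_right subset_iff cong: sum.cong)
qed

lemma norm_expansion_le:
  assumes "finite A" "A \<subseteq> multi_indices d" "\<And>k. k \<in> A \<Longrightarrow> ev k \<le> c" "c \<ge> 0"
  shows "(norm (\<Sum>k\<in>A. inner x (left k) *\<^sub>R right k))\<^sup>2 \<le> c * (norm x)\<^sup>2"
proof -
  have "(norm (\<Sum>k\<in>A. inner x (left k) *\<^sub>R right k))\<^sup>2 \<le> (\<Sum>k\<in>A. c * (inner x (left k))\<^sup>2)"
    unfolding norm_expansion[OF assms(1,2)]
    by (rule sum_mono) (use assms(3) in \<open>simp add: mult.commute mult_right_mono\<close>)
  also have "\<dots> \<le> c * (norm x)\<^sup>2"
    unfolding sum_distrib_left[symmetric] by (intro mult_left_mono Bessel_left assms)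
  finally show ?thesis .
qed

section \<open>Singular value expansion of the tensor power\<close>

lemma finite_cube: "finite (cube d N)"
  by (intro finite_PiE) auto

lemma cube_subset: "cube d N \<subseteq> multi_indices d"
  by (rule PiE_mono) auto

text \<open>The singular value series, a concrete candidate for the operator that
  \<open>tensor_operator\<close> chooses. It is defined on the whole Hilbert space and serves as the
  witness of existence.\<close>

definition power_op where
  "power_op x = lim (\<lambda>N. \<Sum>k\<in>cube d N. inner x (left k) *\<^sub>R right k)"

lemma power_op_LIMSEQ: "(\<lambda>N. \<Sum>k\<in>cube d N. inner x (left k) *\<^sub>R right k) \<longlonglongrightarrow> power_op x"
proof -
  have "convergent (\<lambda>N. \<Sum>k\<in>cube d N. inner x (left k) *\<^sub>R right k)"
  proof (rule orthogonal_series_convergent[OF finite_cube])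
    show "mono (cube d)" by (rule monoI) (rule cube_mono)
    show "inner (inner x (left i) *\<^sub>R right i) (inner x (left j) *\<^sub>R right j) = 0"
      if "i \<in> (\<Union>N. cube d N)" "j \<in> (\<Union>N. cube d N)" "i \<noteq> j" for i j
      using that cube_subset inner_right[of i j] by auto
    fix N
    have "(\<Sum>k\<in>cube d N. (norm (inner x (left k) *\<^sub>R right k))\<^sup>2)
        = (norm (\<Sum>k\<in>cube d N. inner x (left k) *\<^sub>R right k))\<^sup>2"
      unfolding norm_expansion[OF finite_cube cube_subset]
      by (rule sum.cong) (simp_all add: power_mult_distrib norm_right subsetD[OF cube_subset])
    also have "\<dots> \<le> lam 0 ^ d * (norm x)\<^sup>2"
      by (rule norm_expansion_le) (use finite_cube cube_subset ev_le nonneg in auto)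
    finally show "(\<Sum>k\<in>cube d N. (norm (inner x (left k) *\<^sub>R right k))\<^sup>2) \<le> lam 0 ^ d * (norm x)\<^sup>2" .
  qed
  then show ?thesis unfolding power_op_def by (simp add: convergent_LIMSEQ_iff)
qed

text \<open>For every cube that contains \<open>K\<close>, the remaining terms are orthogonal with
  \<open>ev k \<le> c\<close>, so Pythagoras and Bessel bound their sum; the bound passes to the
  limit. With \<open>K = {}\<close> it gives boundedness of the operator, with
  \<open>K = {k. ev k > \<epsilon>^2}\<close> the error of truncation.\<close>

lemma power_op_approx:
  assumes K: "finite K" "K \<subseteq> multi_indices d"
    and c: "\<And>k. k \<in> multi_indices d - K \<Longrightarrow> ev k \<le> c" "c \<ge> 0"
  shows "(norm (power_op x - (\<Sum>k\<in>K. inner x (left k) *\<^sub>R right k)))\<^sup>2 \<le> c * (norm x)\<^sup>2"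
proof -
  let ?T = "\<lambda>A. \<Sum>k\<in>A. inner x (left k) *\<^sub>R right k"
  obtain M where M: "K \<subseteq> cube d M" using finite_multi_indices_cube[OF K] by metis
  have "(\<lambda>N. (norm (?T (cube d N) - ?T K))\<^sup>2) \<longlonglongrightarrow> (norm (power_op x - ?T K))\<^sup>2"
    by (intro tendsto_power tendsto_norm tendsto_diff power_op_LIMSEQ tendsto_const)
  moreover have "(norm (?T (cube d N) - ?T K))\<^sup>2 \<le> c * (norm x)\<^sup>2" if "N \<ge> M" for N
  proof -
    have "K \<subseteq> cube d N" using M cube_mono[OF that] by (rule subset_trans)
    then have "?T (cube d N) - ?T K = ?T (cube d N - K)" by (simp add: sum_diff finite_cube)
    moreover have "(norm (?T (cube d N - K)))\<^sup>2 \<le> c * (norm x)\<^sup>2"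
      by (rule norm_expansion_le) (use finite_cube cube_subset[of N] c in auto)
    ultimately show ?thesis by simp
  qed
  ultimately show ?thesis by (meson LIMSEQ_le_const2)
qed

lemma bounded_linear_power_op: "bounded_linear power_op"
proof (rule bounded_linear_intro)
  show "power_op (x + y) = power_op x + power_op y" for x y
  proof -
    have "(\<lambda>N. \<Sum>k\<in>cube d N. inner (x + y) (left k) *\<^sub>R right k) \<longlonglongrightarrow> power_op x + power_op y"
      using tendsto_add[OF power_op_LIMSEQ[of x] power_op_LIMSEQ[of y]]
      by (simp add: inner_add_left scaleR_add_left sum.distrib)
    then show ?thesis by (rule LIMSEQ_unique[OF power_op_LIMSEQ])
  qed
  show "power_op (r *\<^sub>R x) = r *\<^sub>R power_op x" for r x
  proof -
    have "(\<lambda>N. \<Sum>k\<in>cube d N. inner (r *\<^sub>R x) (left k) *\<^sub>R right k) \<longlonglongrightarrow> r *\<^sub>R power_op x"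
      using tendsto_scaleR[OF tendsto_const[of r] power_op_LIMSEQ[of x]]
      by (simp add: scaleR_sum_right)
    then show ?thesis by (rule LIMSEQ_unique[OF power_op_LIMSEQ])
  qed
  show "norm (power_op x) \<le> norm x * sqrt (lam 0 ^ d)" for x
  proof -
    have "(norm (power_op x))\<^sup>2 \<le> lam 0 ^ d * (norm x)\<^sup>2"
      using power_op_approx[of "{}" "lam 0 ^ d" x] ev_le nonneg by simp
    from real_sqrt_le_mono[OF this] show ?thesis
      by (simp add: real_sqrt_mult mult.commute)
  qed
qed

text \<open>The squared distance of the truncation \<open>?T N\<close> from \<open>?y\<close> is
  \<open>(norm ?y)^2 - ?p N\<close>. Since sums over a cube factor, \<open>?p N\<close> is a product
  of partial sums, one per coordinate, and \<open>norm_sums\<close> makes it converge to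
  \<open>(norm ?y)^2\<close>.\<close>

lemma power_op_simple: "power_op (t d f) = u d (S \<circ> f)"
proof -
  let ?T = "\<lambda>N. \<Sum>k\<in>cube d N. inner (t d f) (left k) *\<^sub>R right k"
  let ?y = "u d (S \<circ> f)"
  let ?p = "\<lambda>N. \<Prod>i=1..d. \<Sum>m<N. lam m * (inner (e m) (f i))\<^sup>2"
  have coef: "inner (t d f) (left k) = (\<Prod>i=1..d. inner (f i) (e (k i)))" for k
    by (simp add: left_def tensor_realization_inner[OF realization_t d])
  have right: "inner (right k) ?y = ev k * inner (t d f) (left k)" for k
    unfolding right_def tensor_realization_inner[OF realization_u d] ev_def coef prod.distrib[symmetric]
    by (rule prod.cong) (simp_all add: singular inner_commute[of "f _"])
  have sq: "(\<Sum>k\<in>cube d N. (inner (t d f) (left k))\<^sup>2 * ev k) = ?p N" for N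
    by (simp add: prod_sum_PiE coef ev_def prod_power_distrib prod.distrib inner_commute mult.commute)
  have "(norm (?T N - ?y))\<^sup>2 = (norm ?y)\<^sup>2 - ?p N" for N
  proof -
    have "(norm (?T N - ?y))\<^sup>2 = (norm (?T N))\<^sup>2 + (norm ?y)\<^sup>2 - 2 * inner (?T N) ?y"
      unfolding power2_norm_eq_inner by (simp add: inner_diff inner_commute)
    also have "inner (?T N) ?y = ?p N"
      unfolding sq[symmetric] by (simp add: inner_sum_left right power2_eq_square ac_simps)
    also have "(norm (?T N))\<^sup>2 = ?p N"
      unfolding norm_expansion[OF finite_cube cube_subset] by (rule sq)
    finally show ?thesis by linarith
  qed
  moreover have "(\<lambda>N. (norm ?y)\<^sup>2 - ?p N) \<longlonglongrightarrow> (norm ?y)\<^sup>2 - (\<Prod>i=1..d. (norm (S (f i)))\<^sup>2)"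
    using norm_sums by (intro tendsto_diff tendsto_const tendsto_prod) (simp add: sums_def)
  moreover have "(norm ?y)\<^sup>2 = (\<Prod>i=1..d. (norm (S (f i)))\<^sup>2)"
    by (simp add: power2_norm_eq_inner tensor_realization_inner[OF realization_u d])
  ultimately have "(\<lambda>N. (norm (?T N - ?y))\<^sup>2) \<longlonglongrightarrow> 0" by simp
  from tendsto_real_sqrt[OF this] have "(\<lambda>N. norm (?T N - ?y)) \<longlonglongrightarrow> 0" by simp
  then have "?T \<longlonglongrightarrow> ?y" by (simp add: LIM_zero_iff tendsto_norm_zero_iff)
  then show ?thesis using LIMSEQ_unique[OF power_op_LIMSEQ] by blast
qed

lemma tensor_operator:
  shows bounded_linear_on_tensor_operator: "bounded_linear_on (tensor_space t d) (tensor_operator t u S d)"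
    and tensor_operator_simple: "tensor_operator t u S d (t d f) = u d (S \<circ> f)"
proof -
  have "\<exists>T. bounded_linear_on (tensor_space t d) T \<and> (\<forall>f. T (t d f) = u d (S \<circ> f))"
    using bounded_linear_imp_on[OF bounded_linear_power_op] power_op_simple by blast
  from someI_ex[OF this]
  show "bounded_linear_on (tensor_space t d) (tensor_operator t u S d)"
    and "tensor_operator t u S d (t d f) = u d (S \<circ> f)"
    unfolding tensor_operator_def tensor_lift_def by blast+
qed

text \<open>Off \<open>tensor_space\<close> the chosen operator is arbitrary, so agreement with the
  series is confined to this space, which contains the antisymmetric ones.\<close>

lemma tensor_operator_eq:
  assumes "x \<in> tensor_space t d"
  shows "tensor_operator t u S d x = power_op x"
proof (rule closed_span_unique[where R = "range (t d)"])
  show "x \<in> closure (span (range (t d)))" using assms by (simp add: tensor_space_def)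
qed (use bounded_linear_on_tensor_operator tensor_operator_simple power_op_simple
    bounded_linear_imp_on[OF bounded_linear_power_op] in \<open>auto simp: tensor_space_def\<close>)

end

section \<open>Antisymmetric subspaces\<close>

text \<open>Permuting the coordinates only reorders the factors of the product formula for inner
  products. So the Gram matrix of the simple tensors is preserved and
  \<open>isometric_extension\<close> produces the operator.\<close>

lemma (in tensor_problem) perm_operator:
  assumes "\<pi> permutes {1..d}"
  shows bounded_linear_on_perm_operator: "bounded_linear_on (tensor_space t d) (perm_operator t d \<pi>)"
    and perm_operator_simple: "perm_operator t d \<pi> (t d f) = t d (f \<circ> \<pi>)"
proof -
  have "inner (t d f) (t d g) = inner (t d (f \<circ> \<pi>)) (t d (g \<circ> \<pi>))" for f g
    unfolding tensor_realization_inner[OF realization_t d]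
    using prod.permute[OF assms, of "\<lambda>i. inner (f i) (g i)"] by (simp add: o_def)
  then have "\<exists>T. bounded_linear_on (tensor_space t d) T \<and> (\<forall>f. T (t d f) = t d (f \<circ> \<pi>))"
    unfolding tensor_space_def by (rule isometric_extension)
  from someI_ex[OF this]
  show "bounded_linear_on (tensor_space t d) (perm_operator t d \<pi>)"
    and "perm_operator t d \<pi> (t d f) = t d (f \<circ> \<pi>)"
    unfolding perm_operator_def tensor_lift_def by blast+
qed

lemma simple_in_tensor_space: "t d f \<in> tensor_space t d"
  unfolding tensor_space_def by (rule closed_span_superset) simp

lemma subspace_tensor_space: "subspace (tensor_space t d)"
  unfolding tensor_space_def by (rule subspace_closed_span)

context tensor_problem
begin

text \<open>The adjoint of a permutation operator is the operator of the inverse permutation, here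
  tested against simple tensors, which is the form that the coefficients take.\<close>

lemma inner_perm_operator:
  assumes \<pi>: "\<pi> permutes {1..d}" and y: "y \<in> tensor_space t d"
  shows "inner (perm_operator t d \<pi> y) (t d g) = inner y (t d (g \<circ> inv \<pi>))"
proof (rule closed_span_unique[where R = "range (t d)" and T = "\<lambda>y. inner (perm_operator t d \<pi> y) (t d g)"])
  show "bounded_linear_on (closure (span (range (t d)))) (\<lambda>y. inner (perm_operator t d \<pi> y) (t d g))"
    using bounded_linear_on_compose[OF bounded_linear_on_perm_operator[OF \<pi>] bounded_linear_inner_left]
    by (simp add: tensor_space_def)
  show "bounded_linear_on (closure (span (range (t d)))) (\<lambda>y. inner y (t d (g \<circ> inv \<pi>)))"
    by (rule bounded_linear_imp_on[OF bounded_linear_inner_left])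
  fix r assume "r \<in> range (t d)"
  then obtain f where r: "r = t d f" by blast
  show "inner (perm_operator t d \<pi> r) (t d g) = inner r (t d (g \<circ> inv \<pi>))"
    unfolding r perm_operator_simple[OF \<pi>] tensor_realization_inner[OF realization_t d]
    using prod.permute[OF \<pi>, of "\<lambda>i. inner (f i) ((g \<circ> inv \<pi>) i)"] permutes_inverses(2)[OF \<pi>]
    by (simp add: o_def)
qed (use y in \<open>simp add: tensor_space_def\<close>)

lemma perm_operator_in:
  assumes \<pi>: "\<pi> permutes {1..d}" and y: "y \<in> tensor_space t d"
  shows "perm_operator t d \<pi> y \<in> tensor_space t d"
proof (rule closed_span_mem[where R = "range (t d)" and W = "tensor_space t d"
      and T = "perm_operator t d \<pi>"])
  show "bounded_linear_on (closure (span (range (t d)))) (perm_operator t d \<pi>)"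
    using bounded_linear_on_perm_operator[OF \<pi>] by (simp add: tensor_space_def)
  show "perm_operator t d \<pi> r \<in> tensor_space t d" if r: "r \<in> range (t d)" for r
    using r perm_operator_simple[OF \<pi>] simple_in_tensor_space[of t d] by auto
qed (use y subspace_tensor_space in \<open>auto simp: tensor_space_def\<close>)

lemma antisymmetric_subset:
  assumes "I \<subseteq> {1..d}"
  shows "antisymmetric_space t d I \<subseteq> tensor_space t d"
proof -
  have "perm_operator t d \<pi> y \<in> tensor_space t d" if "\<pi> permutes I" "y \<in> tensor_space t d" for \<pi> y
    using perm_operator_in[OF permutes_subset[OF that(1) assms] that(2)] .
  then show ?thesis
    unfolding antisymmetric_space_def antisymmetrizer_def
    by (auto intro!: subspace_scale[OF subspace_tensor_space] subspace_sum[OF subspace_tensor_space])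
qed

lemma zero_in_antisymmetric:
  assumes "I \<subseteq> {1..d}"
  shows "0 \<in> antisymmetric_space t d I"
proof -
  have "perm_operator t d \<pi> 0 = 0" if "\<pi> permutes I" for \<pi>
    using bounded_linear_on_sum[OF subspace_tensor_space
        bounded_linear_on_perm_operator[OF permutes_subset[OF that assms]], of "{}"] by simp
  then have "antisymmetrizer t d I 0 = 0" by (simp add: antisymmetrizer_def)
  then show ?thesis unfolding antisymmetric_space_def
    by (metis imageI subspace_0 subspace_tensor_space)
qed

text \<open>Antisymmetry in terms of coefficients. Replacing \<pi> by \<pi> \<circ> \<rho> in the
  sum over the permutation group cancels \<rho> inside the tensor and leaves the factor
  \<open>sign \<rho>\<close>.\<close>

lemma inner_antisymmetric_permute:
  assumes I: "I \<subseteq> {1..d}" and x: "x \<in> antisymmetric_space t d I" and \<rho>: "\<rho> permutes I"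
  shows "inner x (t d (g \<circ> \<rho>)) = of_int (sign \<rho>) * inner x (t d g)"
proof -
  obtain y where y: "y \<in> tensor_space t d" "x = antisymmetrizer t d I y"
    using x by (auto simp: antisymmetric_space_def)
  have fin: "finite I" using I finite_subset by blast
  let ?P = "{\<pi>. \<pi> permutes I}"
  let ?c = "1 / real (card ?P)"
  have inner_x: "inner x (t d h) = ?c * (\<Sum>\<pi>\<in>?P. of_int (sign \<pi>) * inner y (t d (h \<circ> inv \<pi>)))" for h
  proof -
    have "inner x (t d h) = ?c * (\<Sum>\<pi>\<in>?P. of_int (sign \<pi>) * inner (perm_operator t d \<pi> y) (t d h))"
      by (simp add: y(2) antisymmetrizer_def inner_sum_left)
    also have "(\<Sum>\<pi>\<in>?P. of_int (sign \<pi>) * inner (perm_operator t d \<pi> y) (t d h))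
        = (\<Sum>\<pi>\<in>?P. of_int (sign \<pi>) * inner y (t d (h \<circ> inv \<pi>)))"
      by (rule sum.cong) (simp_all add: inner_perm_operator[OF permutes_subset[OF _ I] y(1)])
    finally show ?thesis .
  qed
  have "(\<Sum>\<pi>\<in>?P. of_int (sign \<pi>) * inner y (t d ((g \<circ> \<rho>) \<circ> inv \<pi>)))
      = (\<Sum>\<pi>\<in>?P. of_int (sign (\<pi> \<circ> \<rho>)) * inner y (t d ((g \<circ> \<rho>) \<circ> inv (\<pi> \<circ> \<rho>))))"
    by (rule sum_permutations_compose_right[OF \<rho>])
  also have "\<dots> = (\<Sum>\<pi>\<in>?P. of_int (sign \<rho>) * (of_int (sign \<pi>) * inner y (t d (g \<circ> inv \<pi>))))"
  proof (rule sum.cong)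
    fix \<pi> assume "\<pi> \<in> ?P"
    then have \<pi>: "\<pi> permutes I" by simp
    have "sign (\<pi> \<circ> \<rho>) = sign \<pi> * sign \<rho>"
      using \<pi> \<rho> fin by (intro sign_compose permutation_permutes[THEN iffD2]) blast+
    moreover have "(g \<circ> \<rho>) \<circ> inv (\<pi> \<circ> \<rho>) = g \<circ> inv \<pi>"
      using permutes_inv_o(1)[OF \<rho>] o_inv_distrib[OF permutes_bij[OF \<pi>] permutes_bij[OF \<rho>]]
      by (simp add: fun_eq_iff o_def)
    ultimately show "of_int (sign (\<pi> \<circ> \<rho>)) * inner y (t d ((g \<circ> \<rho>) \<circ> inv (\<pi> \<circ> \<rho>)))
        = of_int (sign \<rho>) * (of_int (sign \<pi>) * inner y (t d (g \<circ> inv \<pi>)))" by simp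
  qed simp
  finally show ?thesis
    unfolding inner_x by (simp add: sum_distrib_left[symmetric])
qed

text \<open>Exchanging two coordinates in \<open>I\<close> with the same index leaves
  \<open>left k\<close> unchanged but reverses the sign of the coefficient, which must therefore be
  0.\<close>

lemma inner_antisymmetric_zero:
  assumes I: "I \<subseteq> {1..d}" and x: "x \<in> antisymmetric_space t d I" and k: "\<not> inj_on k I"
  shows "inner x (left k) = 0"
proof -
  obtain i j where ij: "i \<in> I" "j \<in> I" "i \<noteq> j" "k i = k j" using k by (auto simp: inj_on_def)
  have "left k = t d ((e \<circ> k) \<circ> Transposition.transpose i j)"
  proof -
    have "k (Transposition.transpose i j m) = k m" for m
      using ij(4) by (simp add: Transposition.transpose_def)
    then show ?thesis by (simp add: left_def o_def)
  qed
  then have "inner x (left k) = of_int (sign (Transposition.transpose i j)) * inner x (t d (e \<circ> k))"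
    using inner_antisymmetric_permute[OF I x permutes_swap_id[OF ij(1,2)], of "e \<circ> k"] by simp
  then show ?thesis using ij(3) by (simp add: left_def o_def sign_swap_id)
qed

end

section \<open>Upper bound for the information complexity\<close>

lemma linear_algorithm_bounded:
  assumes "A \<in> linear_algorithms F G n"
  obtains K where "\<And>f. f \<in> F \<Longrightarrow> norm (A f) \<le> K * norm f"
proof -
  obtain L :: "nat \<Rightarrow> 'a \<Rightarrow> real" and g where L: "\<And>j. j \<in> {1..n} \<Longrightarrow> bounded_linear_on F (L j)"
    and A: "A = (\<lambda>f. \<Sum>j=1..n. L j f *\<^sub>R g j)"
    using assms unfolding linear_algorithms_def by blast
  have "\<exists>K. \<forall>f\<in>F. norm (L j f) \<le> K * norm f" if "j \<in> {1..n}" for j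
    using L[OF that] unfolding bounded_linear_on_def by blast
  then obtain K where K: "\<And>j f. j \<in> {1..n} \<Longrightarrow> f \<in> F \<Longrightarrow> norm (L j f) \<le> K j * norm f" by metis
  have "norm (A f) \<le> (\<Sum>j=1..n. K j * norm (g j)) * norm f" if f: "f \<in> F" for f
  proof -
    have "norm (A f) \<le> (\<Sum>j=1..n. norm (L j f *\<^sub>R g j))" unfolding A by (rule norm_sum)
    also have "\<dots> \<le> (\<Sum>j=1..n. (K j * norm f) * norm (g j))"
      unfolding norm_scaleR using K[OF _ f] by (intro sum_mono mult_right_mono) auto
    finally show ?thesis by (simp add: sum_distrib_left ac_simps)
  qed
  then show ?thesis by (rule that)
qed

text \<open>\<open>SUP\<close> over an unbounded set of reals is unspecified, so boundedness of the
  errors has to accompany each estimate of \<open>minimal_error\<close>.\<close>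

lemma bdd_above_error:
  assumes S: "bounded_linear_on F S" and A: "A \<in> linear_algorithms F G n"
  shows "bdd_above ((\<lambda>f. norm (S f - A f)) ` {f \<in> F. norm f \<le> 1})"
proof -
  obtain K where K: "\<And>f. f \<in> F \<Longrightarrow> norm (A f) \<le> K * norm f" using linear_algorithm_bounded[OF A] by metis
  obtain K' where K': "\<And>f. f \<in> F \<Longrightarrow> norm (S f) \<le> K' * norm f" using bounded_linear_on_bound[OF S] by metis
  have "norm (S f - A f) \<le> \<bar>K\<bar> + \<bar>K'\<bar>" if f: "f \<in> F" "norm f \<le> 1" for f
  proof -
    have 1: "c * norm f \<le> \<bar>c\<bar>" for c :: real
      using mult_mono[of c "\<bar>c\<bar>" "norm f" 1] f(2) by simp
    show ?thesis
      using norm_triangle_ineq4[of "S f" "A f"] K[OF f(1)] K'[OF f(1)] 1[of K] 1[of K'] by linarith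
  qed
  then show ?thesis by (intro bdd_aboveI2) auto
qed

lemma minimal_error_le:
  assumes S: "bounded_linear_on F S" and "0 \<in> F" and A: "A \<in> linear_algorithms F G n"
    and le: "\<And>f. f \<in> F \<Longrightarrow> norm f \<le> 1 \<Longrightarrow> norm (S f - A f) \<le> \<epsilon>"
  shows "minimal_error F G S n \<le> \<epsilon>"
proof -
  have "bdd_below ((\<lambda>A. SUP f\<in>{f \<in> F. norm f \<le> 1}. norm (S f - A f)) ` linear_algorithms F G n)"
  proof (rule bdd_belowI2)
    fix A assume A: "A \<in> linear_algorithms F G n"
    have "0 \<le> norm (S 0 - A 0)" by simp
    also have "\<dots> \<le> (SUP f\<in>{f \<in> F. norm f \<le> 1}. norm (S f - A f))"
      by (rule cSUP_upper[OF _ bdd_above_error[OF S A]]) (use \<open>0 \<in> F\<close> in simp)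
    finally show "0 \<le> (SUP f\<in>{f \<in> F. norm f \<le> 1}. norm (S f - A f))" .
  qed
  then have "minimal_error F G S n \<le> (SUP f\<in>{f \<in> F. norm f \<le> 1}. norm (S f - A f))"
    unfolding minimal_error_def by (rule cINF_lower[OF _ A])
  also have "\<dots> \<le> \<epsilon>"
    by (rule cSUP_least) (use \<open>0 \<in> F\<close> le in auto)
  finally show ?thesis .
qed

lemma le_minimal_error:
  assumes S: "bounded_linear_on F S" and "0 \<in> G"
    and ex: "\<And>A. A \<in> linear_algorithms F G n \<Longrightarrow> \<exists>f\<in>F. norm f \<le> 1 \<and> \<epsilon> \<le> norm (S f - A f)"
  shows "\<epsilon> \<le> minimal_error F G S n"
  unfolding minimal_error_def
proof (rule cINF_greatest)
  have "(\<lambda>f. \<Sum>j=1..n. 0 *\<^sub>R 0) \<in> linear_algorithms F G n"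
    unfolding linear_algorithms_def
    by (intro CollectI exI[of _ "\<lambda>_ _. 0"] exI[of _ "\<lambda>_. 0"])
      (use \<open>0 \<in> G\<close> in \<open>simp add: bounded_linear_imp_on\<close>)
  then show "linear_algorithms F G n \<noteq> {}" by blast
  fix A assume A: "A \<in> linear_algorithms F G n"
  then obtain f where "f \<in> F" "norm f \<le> 1" "\<epsilon> \<le> norm (S f - A f)" using ex by blast
  then show "\<epsilon> \<le> (SUP f\<in>{f \<in> F. norm f \<le> 1}. norm (S f - A f))"
    using cSUP_upper[OF _ bdd_above_error[OF S A], of f] by auto
qed

context tensor_problem
begin

text \<open>Antisymmetry makes the coefficients along an orbit of multi-indices under the permutations of
  \<open>I\<close> agree up to sign, and kills those of multi-indices that are not injective on \<open>I\<close>. So one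
  functional per orbit suffices, and each orbit has \<open>fact (card I)\<close> elements.\<close>

lemma antisymmetric_error_upper:
  assumes I: "I \<subseteq> {1..d}" and \<epsilon>: "\<epsilon> \<ge> 0" and fin: "finite {k \<in> multi_indices d. ev k > \<epsilon>\<^sup>2}"
  shows "\<exists>n. n * fact (card I) \<le> card {k \<in> multi_indices d. ev k > \<epsilon>\<^sup>2} \<and>
    minimal_error (antisymmetric_space t d I) (tensor_space u d) (tensor_operator t u S d) n \<le> \<epsilon>"
proof -
  define K where "K = {k \<in> multi_indices d. ev k > \<epsilon>\<^sup>2}"
  define Kinj where "Kinj = {k \<in> K. inj_on k I}"
  define P where "P = {\<pi>. \<pi> permutes I}"
  define orb where "orb k = (\<lambda>\<pi>. k \<circ> \<pi>) ` P" for k :: "nat \<Rightarrow> nat"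
  have finK: "finite K" using fin by (simp add: K_def)
  then have finKinj: "finite Kinj" unfolding Kinj_def by simp
  have finI: "finite I" using I finite_subset by blast
  have finP: "finite P" by (simp add: P_def finI finite_permutations)
  have permd: "\<pi> permutes {1..d}" if "\<pi> \<in> P" for \<pi>
    using permutes_subset[OF _ I] that by (simp add: P_def)
  have comp: "k \<circ> \<pi> \<in> Kinj" if k: "k \<in> Kinj" and \<pi>: "\<pi> \<in> P" for k \<pi>
  proof -
    have "k \<circ> \<pi> \<in> multi_indices d"
      using k permutes_not_in[OF permd[OF \<pi>]] by (auto simp: Kinj_def K_def PiE_iff extensional_def)
    moreover have "ev (k \<circ> \<pi>) = ev k"
      using prod.permute[OF permd[OF \<pi>], of "\<lambda>i. lam (k i)"] by (simp add: ev_def o_def)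
    moreover have "inj_on (k \<circ> \<pi>) I"
      using k \<pi> permutes_inj_on[of \<pi> I I] permutes_image[of \<pi> I]
      by (intro comp_inj_on) (auto simp: P_def Kinj_def)
    ultimately show ?thesis using k by (simp add: Kinj_def K_def)
  qed
  \<comment> \<open>Injectivity of \<open>k\<close> on \<open>I\<close> makes the action of the
    permutations free; this is the reason why each orbit has the full size
    \<open>fact (card I)\<close>.\<close>
  have inj_comp: "inj_on (\<lambda>\<pi>. k \<circ> \<pi>) P" if k: "k \<in> Kinj" for k
  proof (rule inj_onI)
    fix \<pi> \<sigma> assume \<pi>: "\<pi> \<in> P" and \<sigma>: "\<sigma> \<in> P" and eq: "k \<circ> \<pi> = k \<circ> \<sigma>"
    show "\<pi> = \<sigma>"
    proof
      fix i
      show "\<pi> i = \<sigma> i"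
      proof (cases "i \<in> I")
        case True
        then have "\<pi> i \<in> I" "\<sigma> i \<in> I" using \<pi> \<sigma> by (simp_all add: P_def permutes_in_image)
        moreover have "k (\<pi> i) = k (\<sigma> i)" using fun_cong[OF eq, of i] by simp
        ultimately show ?thesis using k by (simp add: Kinj_def inj_on_def)
      next
        case False
        then show ?thesis using \<pi> \<sigma> by (simp add: P_def permutes_not_in)
      qed
    qed
  qed
  have card_orb: "card (orb k) = fact (card I)" if "k \<in> Kinj" for k
  proof -
    have "card (orb k) = card P" unfolding orb_def by (rule card_image[OF inj_comp[OF that]])
    then show ?thesis unfolding P_def card_permutations[OF refl finI] .
  qed
  have self: "k \<in> orb k" for k
    unfolding orb_def by (rule image_eqI[of _ _ id]) (simp_all add: P_def permutes_id)
  have orb_eq: "orb l = orb k" if l: "l \<in> orb k" for k l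
  proof -
    have sub: "orb (k \<circ> \<pi>) \<subseteq> orb k" if "\<pi> \<in> P" for k :: "nat \<Rightarrow> nat" and \<pi>
    proof
      fix m assume "m \<in> orb (k \<circ> \<pi>)"
      then obtain \<sigma> where "\<sigma> \<in> P" "m = (k \<circ> \<pi>) \<circ> \<sigma>" by (auto simp: orb_def)
      then have "m = k \<circ> (\<pi> \<circ> \<sigma>)" "\<pi> \<circ> \<sigma> \<in> P"
        using that permutes_compose by (auto simp: P_def o_assoc)
      then show "m \<in> orb k" unfolding orb_def by blast
    qed
    obtain \<pi> where \<pi>: "\<pi> \<in> P" "l = k \<circ> \<pi>" using l by (auto simp: orb_def)
    have inv: "inv \<pi> \<in> P" using \<pi>(1) permutes_inv by (simp add: P_def)
    have "k = l \<circ> inv \<pi>" using \<pi> permutes_inv_o(1)[of \<pi> I] by (simp add: P_def o_assoc[symmetric])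
    then show ?thesis using sub[OF \<pi>(1), of k] sub[OF inv, of l] \<pi>(2) by auto
  qed
  define Q where "Q = orb ` Kinj"
  have finQ: "finite Q" by (simp add: Q_def finKinj)
  have UQ: "\<Union>Q = Kinj"
    using self comp by (auto simp: Q_def orb_def)
  have disj: "O1 \<inter> O2 = {}" if O: "O1 \<in> Q" "O2 \<in> Q" "O1 \<noteq> O2" for O1 O2
  proof (rule ccontr)
    assume "O1 \<inter> O2 \<noteq> {}"
    then obtain l k1 k2 where "l \<in> orb k1" "l \<in> orb k2" "O1 = orb k1" "O2 = orb k2"
      using O by (auto simp: Q_def)
    then show False using orb_eq[of l k1] orb_eq[of l k2] O(3) by simp
  qed
  have "fact (card I) * card Q = card (\<Union>Q)"
    by (rule card_partition) (use finQ UQ finKinj card_orb disj in \<open>auto simp: Q_def\<close>)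
  also have "\<dots> \<le> card K" unfolding UQ by (rule card_mono[OF finK]) (auto simp: Kinj_def)
  finally have card: "card Q * fact (card I) \<le> card K" by (simp add: mult.commute)

  define r where "r = inv_into Kinj orb"
  have r: "r X \<in> Kinj" "orb (r X) = X" if "X \<in> Q" for X
    using that inv_into_into[of X orb Kinj] f_inv_into_f[of X orb Kinj] by (simp_all add: r_def Q_def)
  \<comment> \<open>Along the orbit of \<open>k\<close> the coefficients are
    \<open>sign \<pi>\<close> times that of \<open>k\<close>. Collecting the signed vectors
    \<open>right (k \<circ> \<pi>)\<close> in \<open>g k\<close> thus reduces the share of the orbit
    to one functional.\<close>
  define g where "g k = (\<Sum>\<pi>\<in>P. of_int (sign \<pi>) *\<^sub>R right (k \<circ> \<pi>))" for k
  let ?F = "antisymmetric_space t d I"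
  have orbit_sum: "(\<Sum>l\<in>orb k. inner x (left l) *\<^sub>R right l) = inner x (left k) *\<^sub>R g k"
    if k: "k \<in> Kinj" and x: "x \<in> ?F" for k x
  proof -
    have coef: "inner x (left (k \<circ> \<pi>)) = of_int (sign \<pi>) * inner x (left k)" if "\<pi> \<in> P" for \<pi>
      using inner_antisymmetric_permute[OF I x, of \<pi> "e \<circ> k"] that
      by (simp add: P_def left_def o_def)
    have "(\<Sum>l\<in>orb k. inner x (left l) *\<^sub>R right l) = (\<Sum>\<pi>\<in>P. inner x (left (k \<circ> \<pi>)) *\<^sub>R right (k \<circ> \<pi>))"
      unfolding orb_def by (simp add: sum.reindex[OF inj_comp[OF k]])
    also have "\<dots> = (\<Sum>\<pi>\<in>P. inner x (left k) *\<^sub>R of_int (sign \<pi>) *\<^sub>R right (k \<circ> \<pi>))"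
      by (rule sum.cong) (simp_all add: coef mult.commute)
    finally show ?thesis by (simp add: g_def scaleR_sum_right)
  qed
  obtain b where b: "bij_betw b {1..card Q} Q" using ex_bij_betw_nat_finite_1[OF finQ] by blast
  define A where "A = (\<lambda>x. \<Sum>j=1..card Q. inner x (left (r (b j))) *\<^sub>R g (r (b j)))"
  have g_in: "g k \<in> tensor_space u d" for k
    unfolding g_def right_def
    by (intro subspace_sum subspace_scale subspace_tensor_space simple_in_tensor_space)
  have A_lin: "A \<in> linear_algorithms ?F (tensor_space u d) (card Q)"
    unfolding linear_algorithms_def A_def
    by (intro CollectI exI[of _ "\<lambda>j x. inner x (left (r (b j)))"] exI[of _ "\<lambda>j. g (r (b j))"])
      (simp add: g_in bounded_linear_imp_on[OF bounded_linear_inner_left])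
  have A_eq: "A x = (\<Sum>k\<in>K. inner x (left k) *\<^sub>R right k)" if x: "x \<in> ?F" for x
  proof -
    have "A x = (\<Sum>X\<in>Q. inner x (left (r X)) *\<^sub>R g (r X))"
      unfolding A_def by (rule sum.reindex_bij_betw[OF b])
    also have "\<dots> = (\<Sum>X\<in>Q. \<Sum>l\<in>X. inner x (left l) *\<^sub>R right l)"
    proof (rule sum.cong)
      fix X assume "X \<in> Q"
      then show "inner x (left (r X)) *\<^sub>R g (r X) = (\<Sum>l\<in>X. inner x (left l) *\<^sub>R right l)"
        using orbit_sum[OF r(1) x] r(2) by metis
    qed simp
    also have "\<dots> = (\<Sum>l\<in>\<Union>Q. inner x (left l) *\<^sub>R right l)"
    proof (rule sum.Union_disjoint[symmetric, unfolded o_def])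
      show "\<forall>X\<in>Q. finite X" unfolding Q_def orb_def using finP by simp
      show "\<forall>X\<in>Q. \<forall>Y\<in>Q. X \<noteq> Y \<longrightarrow> X \<inter> Y = {}" using disj by blast
    qed
    \<comment> \<open>Coefficients of indices not injective on \<open>I\<close> vanish, so the sum
      may run over all of \<open>K\<close>. Then the algorithm is a truncation to which
      \<open>power_op_approx\<close> applies with \<open>c = \<epsilon>^2\<close>.\<close>
    also have "\<dots> = (\<Sum>k\<in>K. inner x (left k) *\<^sub>R right k)"
      unfolding UQ by (rule sum.mono_neutral_left[OF finK])
        (use inner_antisymmetric_zero[OF I x] in \<open>auto simp: Kinj_def\<close>)
    finally show ?thesis .
  qed
  have "minimal_error ?F (tensor_space u d) (tensor_operator t u S d) (card Q) \<le> \<epsilon>"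
  proof (rule minimal_error_le[OF _ zero_in_antisymmetric[OF I] A_lin])
    show "bounded_linear_on ?F (tensor_operator t u S d)"
      by (rule bounded_linear_on_subset[OF bounded_linear_on_tensor_operator antisymmetric_subset[OF I]])
    fix x assume x: "x \<in> ?F" "norm x \<le> 1"
    have "x \<in> tensor_space t d" using x antisymmetric_subset[OF I] by blast
    then have "(norm (tensor_operator t u S d x - A x))\<^sup>2
        = (norm (power_op x - (\<Sum>k\<in>K. inner x (left k) *\<^sub>R right k)))\<^sup>2"
      by (simp add: tensor_operator_eq A_eq[OF x(1)])
    also have "\<dots> \<le> \<epsilon>\<^sup>2 * (norm x)\<^sup>2"
      by (rule power_op_approx[OF finK]) (auto simp: K_def)
    also have "\<dots> \<le> \<epsilon>\<^sup>2 * 1" by (intro mult_left_mono power_le_one x) auto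
    finally show "norm (tensor_operator t u S d x - A x) \<le> \<epsilon>"
      using \<epsilon> by (simp add: power2_le_iff_abs_le)
  qed
  then show ?thesis using card unfolding K_def by blast
qed

text \<open>A coordinate beyond \<open>M\<close> contributes a factor so small that the others, each
  at most \<open>B\<close>, cannot compensate for it. The maximum with 1 in \<open>B\<close> allows
  the bound \<open>B ^ d\<close> in place of \<open>B ^ (d - 1)\<close>.\<close>

lemma finite_ev_gt:
  assumes "\<delta> > 0"
  shows "finite {k \<in> multi_indices d. ev k > \<delta>}"
proof -
  define B where "B = max 1 (lam 0)"
  have B: "B \<ge> 1" and lamB: "lam m \<le> B" for m
    using decseqD[OF decseq, of 0 m] by (auto simp: B_def)
  have "\<delta> / B ^ d > 0" using assms B by simp
  then have "\<forall>\<^sub>F m in sequentially. lam m < \<delta> / B ^ d" using lim by (rule order_tendstoD(2)[rotated])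
  then obtain M where M: "\<And>m. m \<ge> M \<Longrightarrow> lam m < \<delta> / B ^ d" by (auto simp: eventually_sequentially)
  have "{k \<in> multi_indices d. ev k > \<delta>} \<subseteq> cube d M"
  proof
    fix k assume k: "k \<in> {k \<in> multi_indices d. ev k > \<delta>}"
    have "k i < M" if i: "i \<in> {1..d}" for i
    proof (rule ccontr)
      assume "\<not> k i < M"
      then have "lam (k i) < \<delta> / B ^ d" using M by simp
      then have lt: "lam (k i) * B ^ d < \<delta>" using B by (simp add: field_simps)
      have "ev k = lam (k i) * (\<Prod>j\<in>{1..d} - {i}. lam (k j))"
        unfolding ev_def by (rule prod.remove) (use i in auto)
      also have "\<dots> \<le> lam (k i) * B ^ d"
      proof (rule mult_left_mono[OF _ nonneg])
        have "(\<Prod>j\<in>{1..d} - {i}. lam (k j)) \<le> (\<Prod>j\<in>{1..d} - {i}. B)"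
          by (rule prod_mono) (simp add: nonneg lamB)
        also have "\<dots> \<le> B ^ d" using B i by (simp add: power_increasing)
        finally show "(\<Prod>j\<in>{1..d} - {i}. lam (k j)) \<le> B ^ d" .
      qed
      finally show False using lt k by simp
    qed
    then show "k \<in> cube d M" using k by (auto simp: PiE_iff)
  qed
  then show ?thesis using finite_cube finite_subset by blast
qed

text \<open>\<open>LEAST\<close> is informative only if some number qualifies; the orbit count
  provides one. The second claim, that the minimum attains the error \<epsilon>, is what the lower
  bound for \<open>d = 1\<close> is confronted with.\<close>

lemma complexity_upper:
  assumes I: "I \<subseteq> {1..d}" and \<epsilon>: "\<epsilon> > 0"
  defines "n \<equiv> info_complexity (antisymmetric_space t d I) (tensor_space u d) (tensor_operator t u S d) \<epsilon>"
  shows "n * fact (card I) \<le> card {k \<in> multi_indices d. ev k > \<epsilon>\<^sup>2}"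
    and "minimal_error (antisymmetric_space t d I) (tensor_space u d) (tensor_operator t u S d) n \<le> \<epsilon>"
proof -
  obtain n' where n': "n' * fact (card I) \<le> card {k \<in> multi_indices d. ev k > \<epsilon>\<^sup>2}"
    "minimal_error (antisymmetric_space t d I) (tensor_space u d) (tensor_operator t u S d) n' \<le> \<epsilon>"
    using antisymmetric_error_upper[OF I _ finite_ev_gt, of \<epsilon>] \<epsilon> by auto
  show "minimal_error (antisymmetric_space t d I) (tensor_space u d) (tensor_operator t u S d) n \<le> \<epsilon>"
    unfolding n_def info_complexity_def by (rule LeastI[of _ n']) (rule n'(2))
  have "n \<le> n'" unfolding n_def info_complexity_def by (rule Least_le) (rule n'(2))
  then have "n * fact (card I) \<le> n' * fact (card I)" by (rule mult_right_mono) simp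
  with n'(1) show "n * fact (card I) \<le> card {k \<in> multi_indices d. ev k > \<epsilon>\<^sup>2}" by linarith
qed

text \<open>An estimate of Markov type: each index counted contributes at least
  \<open>(\<epsilon>^2) powr \<tau>\<close> to the sum of \<open>ev k powr \<tau>\<close>. Over a
  cube this sum is the \<open>d\<close>-th power of a partial sum of the eigenvalue series.\<close>

lemma card_ev_gt:
  assumes \<tau>: "\<tau> > 0" and summ: "summable (\<lambda>m. lam m powr \<tau>)" and \<epsilon>: "\<epsilon> > 0"
  shows "real (card {k \<in> multi_indices d. ev k > \<epsilon>\<^sup>2}) * \<epsilon> powr (2 * \<tau>) \<le> (\<Sum>m. lam m powr \<tau>) ^ d"
proof -
  let ?K = "{k \<in> multi_indices d. ev k > \<epsilon>\<^sup>2}"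
  have finK: "finite ?K" using finite_ev_gt[of "\<epsilon>\<^sup>2"] \<epsilon> by simp
  then obtain N where N: "?K \<subseteq> cube d N"
    using finite_multi_indices_cube[of ?K d] by auto
  have "real (card ?K) * \<epsilon> powr (2 * \<tau>) = (\<Sum>k\<in>?K. (\<epsilon>\<^sup>2) powr \<tau>)"
    using \<epsilon> by (simp add: powr_powr flip: powr_numeral)
  also have "\<dots> \<le> (\<Sum>k\<in>?K. ev k powr \<tau>)"
    by (rule sum_mono) (use \<tau> in \<open>auto intro!: powr_mono2\<close>)
  also have "\<dots> \<le> (\<Sum>k\<in>cube d N. ev k powr \<tau>)"
    by (rule sum_mono2[OF finite_cube N]) simp
  also have "\<dots> = (\<Sum>k\<in>cube d N. \<Prod>i=1..d. lam (k i) powr \<tau>)"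
    unfolding ev_def by (simp add: prod_powr_distrib nonneg)
  also have "\<dots> = (\<Sum>m<N. lam m powr \<tau>) ^ d"
    using prod_sum_PiE[of "{1..d}" "\<lambda>_. {..<N}" "\<lambda>_ m. lam m powr \<tau>"] by simp
  also have "\<dots> \<le> (\<Sum>m. lam m powr \<tau>) ^ d"
    by (intro power_mono sum_le_suminf summ sum_nonneg) auto
  finally show ?thesis .
qed

end

section \<open>Lower bound for a single factor\<close>

text \<open>Fewer equations than unknowns: Gaussian elimination, followed by normalization. It
  provides the unit vector on which \<open>n\<close> given functionals vanish.\<close>

lemma homogeneous_system_solution:
  fixes a :: "nat \<Rightarrow> 'i \<Rightarrow> real"
  assumes "finite A" "card A > n"
  shows "\<exists>c. (\<Sum>i\<in>A. (c i)\<^sup>2) = 1 \<and> (\<forall>j\<in>{1..n}. (\<Sum>i\<in>A. c i * a j i) = 0)"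
proof -
  have "\<exists>c. (\<exists>i\<in>A. c i \<noteq> 0) \<and> (\<forall>j\<in>{1..n}. (\<Sum>i\<in>A. c i * a j i) = 0)"
    using assms
  proof (induction n arbitrary: A a)
    case 0
    then obtain i where "i \<in> A" by fastforce
    then show ?case by (intro exI[of _ "\<lambda>_. 1"]) auto
  next
    case (Suc n)
    show ?case
    proof (cases "\<forall>i\<in>A. a (Suc n) i = 0")
      case True
      obtain c where c: "\<exists>i\<in>A. c i \<noteq> 0" "\<forall>j\<in>{1..n}. (\<Sum>i\<in>A. c i * a j i) = 0"
        using Suc.IH[OF Suc.prems(1), of a] Suc.prems(2) by auto
      have "(\<Sum>i\<in>A. c i * a j i) = 0" if "j \<in> {1..Suc n}" for j
        using c(2) True that by (cases "j = Suc n") auto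
      then show ?thesis using c(1) by blast
    next
      case False
      then obtain p where p: "p \<in> A" "a (Suc n) p \<noteq> 0" by blast
      \<comment> \<open>Pivoting: the last equation is solved for the unknown with index
        \<open>p\<close>, and substitution into the others leaves \<open>n\<close> equations in the
        unknowns of \<open>A - {p}\<close>.\<close>
      define q where "q i = a (Suc n) i / a (Suc n) p" for i
      have "finite (A - {p})" "card (A - {p}) > n" using Suc.prems p(1) by auto
      then obtain c where c: "\<exists>i\<in>A - {p}. c i \<noteq> 0"
        "\<forall>j\<in>{1..n}. (\<Sum>i\<in>A - {p}. c i * (a j i - q i * a j p)) = 0"
        using Suc.IH[of "A - {p}" "\<lambda>j i. a j i - q i * a j p"] by blast
      define c' where "c' i = (if i = p then - (\<Sum>i\<in>A - {p}. c i * q i) else c i)" for i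
      have sum': "(\<Sum>i\<in>A. c' i * a j i) = (\<Sum>i\<in>A - {p}. c i * (a j i - q i * a j p))" for j
      proof -
        have "(\<Sum>i\<in>A. c' i * a j i) = c' p * a j p + (\<Sum>i\<in>A - {p}. c' i * a j i)"
          by (rule sum.remove[OF Suc.prems(1) p(1)])
        also have "(\<Sum>i\<in>A - {p}. c' i * a j i) = (\<Sum>i\<in>A - {p}. c i * a j i)"
          by (rule sum.cong) (auto simp: c'_def)
        finally show ?thesis
          by (simp add: c'_def sum_subtractf right_diff_distrib sum_distrib_right mult.assoc)
      qed
      have "(\<Sum>i\<in>A. c' i * a j i) = 0" if "j \<in> {1..Suc n}" for j
      proof (cases "j = Suc n")
        case True
        have "a (Suc n) i - q i * a (Suc n) p = 0" for i using p(2) by (simp add: q_def)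
        then show ?thesis by (simp only: sum' True mult_zero_right sum.neutral_const)
      next
        case False
        then show ?thesis unfolding sum' using c(2) that by simp
      qed
      moreover have "\<exists>i\<in>A. c' i \<noteq> 0" using c(1) by (auto simp: c'_def)
      ultimately show ?thesis by blast
    qed
  qed
  then obtain c where c: "\<exists>i\<in>A. c i \<noteq> 0" "\<forall>j\<in>{1..n}. (\<Sum>i\<in>A. c i * a j i) = 0" by blast
  define s where "s = sqrt (\<Sum>i\<in>A. (c i)\<^sup>2)"
  have pos: "(\<Sum>i\<in>A. (c i)\<^sup>2) > 0"
  proof -
    obtain i where "i \<in> A" "c i \<noteq> 0" using c(1) by blast
    then show ?thesis by (intro sum_pos2[OF assms(1), of i]) simp_all
  qed
  have "(\<Sum>i\<in>A. (c i / s)\<^sup>2) = 1"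
    using pos by (simp add: power_divide s_def flip: sum_divide_distrib)
  moreover have "(\<Sum>i\<in>A. (c i / s) * a j i) = 0" if "j \<in> {1..n}" for j
    using c(2) that by (simp flip: sum_divide_distrib)
  ultimately show ?thesis by (intro exI[of _ "\<lambda>i. c i / s"]) blast
qed

lemma (in tensor_problem) antisymmetric_space_singleton:
  "antisymmetric_space t d {i} = tensor_space t d" if i: "i \<in> {1..d}"
proof -
  have "perm_operator t d id x = x" if "x \<in> tensor_space t d" for x
  proof (rule closed_span_unique[where R = "range (t d)" and T' = "\<lambda>x. x"])
    show "bounded_linear_on (closure (span (range (t d)))) (perm_operator t d id)"
      using bounded_linear_on_perm_operator[OF permutes_id] by (simp add: tensor_space_def)
    show "bounded_linear_on (closure (span (range (t d)))) (\<lambda>x. x)"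
      by (rule bounded_linear_imp_on[OF bounded_linear_ident])
    show "perm_operator t d id r = r" if "r \<in> range (t d)" for r
      using that perm_operator_simple[OF permutes_id] by auto
  qed (use that in \<open>simp add: tensor_space_def\<close>)
  then show ?thesis
    by (simp add: antisymmetric_space_def antisymmetrizer_def sign_id cong: image_cong)
qed

text \<open>Some unit combination of the \<open>n + 1\<close> vectors \<open>v 0, ..., v n\<close>
  is annihilated by all \<open>n\<close> functionals, so the algorithm returns 0 on it. The squared
  norm of its image is a weighted mean of \<open>lam 0, ..., lam n\<close>, hence at least
  \<open>lam n\<close>, which is the eigenvalue number \<open>n + 1\<close> as indices start at
  0.\<close>

lemma (in tensor_problem) minimal_error_lower:
  assumes d1: "d = 1"
  shows "sqrt (lam n) \<le> minimal_error (tensor_space t d) (tensor_space u d) (tensor_operator t u S d) n"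
proof (rule le_minimal_error[OF bounded_linear_on_tensor_operator subspace_0[OF subspace_tensor_space]])
  let ?T = "tensor_operator t u S d"
  fix A assume A: "A \<in> linear_algorithms (tensor_space t d) (tensor_space u d) n"
  show "\<exists>f\<in>tensor_space t d. norm f \<le> 1 \<and> sqrt (lam n) \<le> norm (?T f - A f)"
  proof (cases "lam n = 0")
    case True
    then show ?thesis by (intro bexI[of _ 0] subspace_0[OF subspace_tensor_space]) simp
  next
    case False
    then have "lam n > 0" using nonneg[of n] by simp
    then have lam_pos: "lam m > 0" if "m \<le> n" for m
      using decseqD[OF decseq that] by linarith
    obtain L :: "nat \<Rightarrow> 'h \<Rightarrow> real" and g where
      L: "\<And>j. j \<in> {1..n} \<Longrightarrow> bounded_linear_on (tensor_space t d) (L j)"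
      and A_eq: "A = (\<lambda>f. \<Sum>j=1..n. L j f *\<^sub>R g j)"
      using A unfolding linear_algorithms_def by blast
    define v where "v m = t d (\<lambda>_. e m)" for m
    obtain c where c: "(\<Sum>m\<le>n. (c m)\<^sup>2) = 1" "\<forall>j\<in>{1..n}. (\<Sum>m\<le>n. c m * L j (v m)) = 0"
      using homogeneous_system_solution[of "{..n}" n "\<lambda>j m. L j (v m)"] by auto
    define f where "f = (\<Sum>m\<le>n. c m *\<^sub>R v m)"
    have v_in: "v m \<in> tensor_space t d" for m by (simp add: v_def simple_in_tensor_space)
    have v_inner: "inner (v i) (v j) = (if i = j \<and> lam i > 0 then 1 else 0)" for i j
      unfolding v_def tensor_realization_inner[OF realization_t d] by (simp add: d1 orthonormal)
    have "(norm f)\<^sup>2 = (\<Sum>m\<le>n. (c m)\<^sup>2 * (norm (v m))\<^sup>2)"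
      unfolding f_def by (rule norm_sum_orthogonal) (auto simp: v_inner)
    also have "\<dots> = (\<Sum>m\<le>n. (c m)\<^sup>2)"
      by (rule sum.cong) (use lam_pos in \<open>auto simp: v_inner power2_norm_eq_inner\<close>)
    finally have "(norm f)\<^sup>2 = 1" using c(1) by simp
    then have norm_f: "norm f \<le> 1" using power2_le_imp_le[of "norm f" 1] by simp
    have f_in: "f \<in> tensor_space t d" unfolding f_def
      by (intro subspace_sum subspace_scale subspace_tensor_space v_in)
    have "L j f = 0" if "j \<in> {1..n}" for j
      using bounded_linear_on_sum[OF subspace_tensor_space L[OF that], of "{..n}" v c] v_in c(2) that
      by (simp add: f_def)
    then have Af: "A f = 0" by (simp add: A_eq)
    define w where "w m = u d (\<lambda>_. S (e m))" for m
    have w_inner: "inner (w i) (w j) = (if i = j then lam i else 0)" for i j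
      unfolding w_def tensor_realization_inner[OF realization_u d]
      using nonneg[of i] by (auto simp: d1 singular orthonormal)
    have "?T f = (\<Sum>m\<le>n. c m *\<^sub>R ?T (v m))"
      unfolding f_def by (rule bounded_linear_on_sum[OF subspace_tensor_space bounded_linear_on_tensor_operator])
        (simp_all add: v_in)
    also have "\<dots> = (\<Sum>m\<le>n. c m *\<^sub>R w m)" by (simp add: v_def w_def tensor_operator_simple o_def)
    finally have "(norm (?T f))\<^sup>2 = (\<Sum>m\<le>n. (c m)\<^sup>2 * (norm (w m))\<^sup>2)"
      by (simp only:) (rule norm_sum_orthogonal, auto simp: w_inner)
    also have "\<dots> = (\<Sum>m\<le>n. (c m)\<^sup>2 * lam m)" by (simp add: power2_norm_eq_inner w_inner)
    also have "\<dots> \<ge> (\<Sum>m\<le>n. (c m)\<^sup>2 * lam n)"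
      by (intro sum_mono mult_left_mono) (auto intro: decseqD[OF decseq])
    finally have "lam n \<le> (norm (?T f))\<^sup>2" using c(1) by (simp flip: sum_distrib_right)
    then have "sqrt (lam n) \<le> norm (?T f)" by (simp add: real_le_lsqrt)
    then show ?thesis using f_in norm_f Af by (intro bexI[of _ f]) simp
  qed
qed

section \<open>Tractability\<close>

text \<open>Raising the exponent by \<open>s\<close> multiplies each term by at most
  \<open>lam 0 ^ s\<close>, which becomes arbitrarily small as \<open>lam 0 < 1\<close>.\<close>

lemma summable_powr_suminf_le_1:
  fixes lam :: "nat \<Rightarrow> real"
  assumes "decseq lam" "\<And>m. 0 \<le> lam m" "lam 0 < 1" "\<tau> > 0" "summable (\<lambda>m. lam m powr \<tau>)"
  obtains \<tau>' where "\<tau>' > 0" "summable (\<lambda>m. lam m powr \<tau>')" "(\<Sum>m. lam m powr \<tau>') \<le> 1"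
proof -
  define B where "B = (\<Sum>m. lam m powr \<tau>)"
  have "(\<lambda>s. lam 0 ^ s * B) \<longlonglongrightarrow> 0 * B"
    using assms(2,3) by (intro tendsto_mult LIMSEQ_realpow_zero tendsto_const)
  then have "\<forall>\<^sub>F s in sequentially. lam 0 ^ s * B < 1"
    by (intro order_tendstoD(2)[where y = "0 * B"]) simp_all
  then obtain s where s: "lam 0 ^ s * B < 1" by (auto simp: eventually_sequentially)
  have le: "lam m powr (\<tau> + real s) \<le> lam 0 ^ s * lam m powr \<tau>" for m
  proof (cases "lam m = 0")
    case False
    then have "lam m powr (\<tau> + real s) = lam m ^ s * lam m powr \<tau>"
      using assms(2)[of m] by (simp add: powr_add powr_realpow)
    also have "\<dots> \<le> lam 0 ^ s * lam m powr \<tau>"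
      by (intro mult_right_mono power_mono decseqD[OF assms(1)] assms(2)) auto
    finally show ?thesis .
  next
    case True
    then show ?thesis by simp
  qed
  have summ: "summable (\<lambda>m. lam 0 ^ s * lam m powr \<tau>)" by (rule summable_mult[OF assms(5)])
  have summ': "summable (\<lambda>m. lam m powr (\<tau> + real s))"
    by (rule summable_comparison_test'[OF summ, of 0]) (simp add: le)
  have "(\<Sum>m. lam m powr (\<tau> + real s)) \<le> (\<Sum>m. lam 0 ^ s * lam m powr \<tau>)"
    by (rule suminf_le[OF le summ' summ])
  also have "\<dots> = lam 0 ^ s * B" unfolding B_def by (rule suminf_mult[OF assms(5)])
  finally show ?thesis using that[of "\<tau> + real s"] summ' s assms(4) by simp
qed

lemma power_over_fact_le_exp:
  fixes x :: real
  assumes "x \<ge> 0"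
  shows "x ^ n / fact n \<le> exp x"
proof -
  have "(\<Sum>k\<in>{n}. x ^ k /\<^sub>R fact k) \<le> (\<Sum>k. x ^ k /\<^sub>R fact k)"
    by (rule sum_le_suminf[OF summable_exp_generic]) (use assms in auto)
  then show ?thesis by (simp add: exp_def field_simps)
qed

text \<open>Linear growth gives \<open>d \<le> s * a d\<close> for large \<open>d\<close>, so the
  power is at most \<open>x ^ a d\<close> with \<open>x = B' ^ s\<close>, and
  \<open>x ^ n / fact n\<close> never exceeds \<open>exp x\<close>. The finitely many other
  \<open>d\<close> are covered by \<open>B' ^ d0\<close>; replacing the base by
  \<open>B' \<ge> 1\<close> makes powers increase with the exponent.\<close>

lemma power_over_fact_bounded:
  fixes a :: "nat \<Rightarrow> nat" and B :: real
  assumes "(\<lambda>d. real (a d)) \<in> \<Omega>(\<lambda>d. real d)"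
  obtains C where "C > 0" "\<And>d. \<bar>B\<bar> ^ d / fact (a d) \<le> C"
proof -
  obtain c where c: "c > 0" "\<forall>\<^sub>F d in sequentially. norm (real (a d)) \<ge> c * norm (real d)"
    using assms by (rule landau_omega.bigE)
  then obtain d0 where d0: "\<And>d. d \<ge> d0 \<Longrightarrow> real (a d) \<ge> c * real d"
    by (auto simp: eventually_sequentially)
  obtain s where s: "1 / c < real s" using reals_Archimedean2 by blast
  define B' where "B' = max 1 \<bar>B\<bar>"
  have B': "B' \<ge> 1" by (simp add: B'_def)
  have le: "\<bar>B\<bar> ^ d \<le> B' ^ d" for d by (rule power_mono) (simp_all add: B'_def)
  show ?thesis
  proof (rule that[of "max (exp (B' ^ s)) (B' ^ d0)"])
    fix d
    show "\<bar>B\<bar> ^ d / fact (a d) \<le> max (exp (B' ^ s)) (B' ^ d0)"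
    proof (cases "d \<ge> d0")
      case True
      have "real d \<le> real s * (c * real d)"
        using s c(1) mult_right_mono[of 1 "real s * c" "real d"] by (simp add: field_simps)
      also have "\<dots> \<le> real s * real (a d)" by (intro mult_left_mono d0 True) simp
      finally have "d \<le> s * a d" by (metis of_nat_le_iff of_nat_mult)
      then have "B' ^ d \<le> (B' ^ s) ^ a d"
        using B' by (metis power_increasing power_mult)
      then have "\<bar>B\<bar> ^ d / fact (a d) \<le> (B' ^ s) ^ a d / fact (a d)"
        using le[of d] by (intro divide_right_mono) auto
      also have "\<dots> \<le> exp (B' ^ s)" by (rule power_over_fact_le_exp) (use B' in simp)
      finally show ?thesis by simp
    next
      case False
      have "\<bar>B\<bar> ^ d / fact (a d) \<le> \<bar>B\<bar> ^ d / 1"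
        by (intro divide_left_mono) (simp_all add: fact_ge_1)
      also have "\<dots> \<le> B' ^ d0"
        using le[of d] power_increasing[of d d0 B'] B' False by simp
      finally show ?thesis by simp
    qed
  qed (simp add: less_max_iff_disj)
qed

text \<open>Solving \<open>C * \<epsilon> powr (- p) = m\<close> for \<epsilon> gives
  \<open>n \<epsilon> \<le> m\<close>, hence \<open>lam m \<le> \<epsilon>^2\<close> and
  \<open>lam m powr p \<le> (C / m)^2\<close>. The square in the error bound is what makes the
  exponent \<open>p\<close> itself summable. Taking \<open>m > C\<close> ensures
  \<open>\<epsilon> \<le> 1\<close>.\<close>

lemma summable_if_polynomial_count:
  fixes lam :: "nat \<Rightarrow> real"
  assumes dec: "decseq lam" and nonneg: "\<And>m. 0 \<le> lam m" and "C > 0" "p > 0"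
    and n: "\<And>\<epsilon>. 0 < \<epsilon> \<Longrightarrow> \<epsilon> \<le> 1 \<Longrightarrow> real (n \<epsilon>) \<le> C * \<epsilon> powr (- p) \<and> lam (n \<epsilon>) \<le> \<epsilon>\<^sup>2"
  shows "summable (\<lambda>m. lam m powr p)"
proof -
  obtain M where M: "C < real M" using reals_Archimedean2 by blast
  have le: "norm (lam m powr p) \<le> C\<^sup>2 * (1 / real m ^ 2)" if m: "m \<ge> M" for m
  proof -
    have pos: "real m > C" using m M by linarith
    then have "m > 0" using \<open>C > 0\<close> by (metis gr0I less_asym of_nat_0)
    define \<epsilon> where "\<epsilon> = (C / real m) powr (1 / p)"
    have base: "0 < C / real m" "C / real m \<le> 1" using pos \<open>C > 0\<close> by (simp_all add: field_simps)
    then have \<epsilon>: "0 < \<epsilon>" "\<epsilon> \<le> 1"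
      using powr_mono2[of "1 / p" "C / real m" 1] \<open>p > 0\<close> \<open>C > 0\<close> \<open>m > 0\<close> by (simp_all add: \<epsilon>_def)
    have ep: "\<epsilon> powr p = C / real m" using base \<open>p > 0\<close> \<open>C > 0\<close> pos by (simp add: \<epsilon>_def powr_powr)
    have "real (n \<epsilon>) \<le> C * \<epsilon> powr (- p)" using n[OF \<epsilon>] by simp
    also have "\<dots> = real m" using ep base \<open>C > 0\<close> pos by (simp add: powr_minus)
    finally have "lam m \<le> lam (n \<epsilon>)" by (intro decseqD[OF dec]) simp
    also have "\<dots> \<le> \<epsilon>\<^sup>2" using n[OF \<epsilon>] by simp
    finally have "lam m powr p \<le> (\<epsilon>\<^sup>2) powr p" using nonneg \<open>p > 0\<close> by (intro powr_mono2) auto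
    also have "\<dots> = (\<epsilon> powr p)\<^sup>2" using \<epsilon> by (simp add: power2_eq_square powr_mult)
    finally show ?thesis using ep by (simp add: power_divide)
  qed
  show ?thesis
  proof (rule summable_comparison_test'[OF _ le])
    show "summable (\<lambda>m. C\<^sup>2 * (1 / real m ^ 2))"
      using inverse_power_summable[of 2, where 'a = real]
      by (intro summable_mult) (simp add: divide_inverse power_inverse)
  qed
qed

theorem theorem6:
  fixes S1 :: "'a::{real_inner,complete_space} \<Rightarrow> 'b::{real_inner,complete_space}"
    and tH :: "nat \<Rightarrow> (nat \<Rightarrow> 'a) \<Rightarrow> 'h::{real_inner,complete_space}"
    and tG :: "nat \<Rightarrow> (nat \<Rightarrow> 'b) \<Rightarrow> 'k::{real_inner,complete_space}"
    and lam :: "nat \<Rightarrow> real"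
    and I :: "nat \<Rightarrow> nat set"
  assumes "tensor_realization tH"
    and "tensor_realization tG"
    and "compact_operator S1"
    and "eigenvalue_seq (adjoint S1 \<circ> S1) lam"
    and "lam 1 > 0"
    and "\<And>d. d \<ge> 1 \<Longrightarrow> I d \<noteq> {} \<and> I d \<subseteq> {1..d}"
    and "lam 0 < 1 \<or> (lam 0 \<ge> 1 \<and> (\<lambda>d. real (card (I d))) \<in> \<Theta>(\<lambda>d. real d))"
  shows "(strongly_polynomially_tractable (antisym_complexity tH tG S1 I) \<longleftrightarrow>
            polynomially_tractable (antisym_complexity tH tG S1 I)) \<and>
         (polynomially_tractable (antisym_complexity tH tG S1 I) \<longleftrightarrow>
            (\<exists>\<tau>>0. summable (\<lambda>m. lam m powr \<tau>)))"
proof -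
  obtain e where "singular_system S1 lam e"
    using singular_system_exists[OF assms(3,4)] by metis
  then interpret singular_system S1 lam e .
  have problem: "tensor_problem S1 lam e tH tG d" if "d \<ge> 1" for d
    by unfold_locales (use assms(1,2) that in auto)
  let ?n = "antisym_complexity tH tG S1 I"
  have Id: "I d \<subseteq> {1..d}" if "d \<ge> 1" for d using assms(6)[OF that] by simp
  have bound: "real (?n \<epsilon> d) \<le> \<epsilon> powr (- (2 * \<tau>)) * ((\<Sum>m. lam m powr \<tau>) ^ d / fact (card (I d)))"
    if \<tau>: "\<tau> > 0" "summable (\<lambda>m. lam m powr \<tau>)" and \<epsilon>: "\<epsilon> > 0" and d: "d \<ge> 1" for \<tau> \<epsilon> d
  proof -
    interpret P: tensor_problem S1 lam e tH tG d by (rule problem[OF d])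
    have "real (?n \<epsilon> d * fact (card (I d))) \<le> real (card {k \<in> multi_indices d. P.ev k > \<epsilon>\<^sup>2})"
      unfolding antisym_complexity_def by (intro of_nat_mono P.complexity_upper(1) Id d \<epsilon>)
    then have "real (?n \<epsilon> d) * fact (card (I d)) \<le> real (card {k \<in> multi_indices d. P.ev k > \<epsilon>\<^sup>2})"
      by (simp only: of_nat_mult of_nat_fact)
    then have "real (?n \<epsilon> d) * fact (card (I d)) * \<epsilon> powr (2 * \<tau>)
        \<le> real (card {k \<in> multi_indices d. P.ev k > \<epsilon>\<^sup>2}) * \<epsilon> powr (2 * \<tau>)"
      by (rule mult_right_mono) simp
    also have "\<dots> \<le> (\<Sum>m. lam m powr \<tau>) ^ d" by (rule P.card_ev_gt[OF \<tau> \<epsilon>])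
    finally have "real (?n \<epsilon> d) * fact (card (I d)) * \<epsilon> powr (2 * \<tau>) \<le> (\<Sum>m. lam m powr \<tau>) ^ d" .
    then show ?thesis using \<epsilon> by (simp add: powr_minus field_simps)
  qed
  have strong: "strongly_polynomially_tractable ?n" if \<tau>: "\<tau> > 0" "summable (\<lambda>m. lam m powr \<tau>)" for \<tau>
  proof -
    \<comment> \<open>What strong tractability asks for is a bound on this quotient uniform in
      \<open>d\<close>. For \<open>lam 0 < 1\<close> a larger exponent bounds the numerator;
      otherwise the given exponent is kept and the factorial controls the quotient.\<close>
    have "\<exists>\<tau>>0. \<exists>C>0. summable (\<lambda>m. lam m powr \<tau>) \<and>
        (\<forall>d. (\<Sum>m. lam m powr \<tau>) ^ d / fact (card (I d)) \<le> C)"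
    proof (cases "lam 0 < 1")
      case True
      obtain \<tau>' where \<tau>': "\<tau>' > 0" "summable (\<lambda>m. lam m powr \<tau>')" "(\<Sum>m. lam m powr \<tau>') \<le> 1"
        using summable_powr_suminf_le_1[OF decseq nonneg True \<tau>] by metis
      have "(\<Sum>m. lam m powr \<tau>') ^ d / fact (card (I d)) \<le> 1" for d
      proof -
        have "(\<Sum>m. lam m powr \<tau>') ^ d \<le> 1" by (intro power_le_one suminf_nonneg \<tau>') simp
        also have "1 \<le> (fact (card (I d)) :: real)" by (rule fact_ge_1)
        finally show ?thesis by simp
      qed
      then show ?thesis using \<tau>' by (intro exI[of _ \<tau>'] conjI exI[of _ 1]) auto
    next
      case False
      then have "(\<lambda>d. real (card (I d))) \<in> \<Omega>(\<lambda>d. real d)"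
        using assms(7) by (simp add: bigtheta_def)
      then obtain C where C: "C > 0" "\<And>d. \<bar>\<Sum>m. lam m powr \<tau>\<bar> ^ d / fact (card (I d)) \<le> C"
        using power_over_fact_bounded[of "\<lambda>d. card (I d)"] by metis
      moreover have "\<bar>\<Sum>m. lam m powr \<tau>\<bar> = (\<Sum>m. lam m powr \<tau>)"
        by (intro abs_of_nonneg suminf_nonneg \<tau>) simp
      ultimately show ?thesis using \<tau> by (intro exI[of _ \<tau>] conjI exI[of _ C]) auto
    qed
    then obtain \<tau>' C where \<tau>': "\<tau>' > 0" "summable (\<lambda>m. lam m powr \<tau>')" and C: "C > 0"
      "\<And>d. (\<Sum>m. lam m powr \<tau>') ^ d / fact (card (I d)) \<le> C" by blast
    have "real (?n \<epsilon> d) \<le> C * \<epsilon> powr (- (2 * \<tau>')) * real d powr 0" if "\<epsilon> \<in> {0<..1}" "d \<ge> 1" for \<epsilon> d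
    proof -
      have "real (?n \<epsilon> d) \<le> \<epsilon> powr (- (2 * \<tau>')) * ((\<Sum>m. lam m powr \<tau>') ^ d / fact (card (I d)))"
        using bound[OF \<tau>'] that by simp
      also have "\<dots> \<le> \<epsilon> powr (- (2 * \<tau>')) * C" by (intro mult_left_mono C) simp
      finally show ?thesis using that by (simp add: mult.commute)
    qed
    then show ?thesis
      unfolding strongly_polynomially_tractable_def tractability_bound_def
      using C(1) \<tau>'(1) by (intro exI[of _ C] conjI exI[of _ "2 * \<tau>'"]) auto
  qed
  have summ: "\<exists>\<tau>>0. summable (\<lambda>m. lam m powr \<tau>)" if "polynomially_tractable ?n"
  proof -
    interpret P: tensor_problem S1 lam e tH tG 1 by (rule problem) simp
    obtain C p q where Cp: "C > 0" "p > 0"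
      "\<And>\<epsilon> d. \<epsilon> \<in> {0<..1} \<Longrightarrow> d \<ge> 1 \<Longrightarrow> real (?n \<epsilon> d) \<le> C * \<epsilon> powr (- p) * real d powr q"
      using \<open>polynomially_tractable ?n\<close> unfolding polynomially_tractable_def tractability_bound_def by metis
    have I1: "I 1 = {1}" using assms(6)[of 1] by auto
    have "summable (\<lambda>m. lam m powr p)"
    proof (rule summable_if_polynomial_count[OF decseq nonneg Cp(1,2), of "\<lambda>\<epsilon>. ?n \<epsilon> 1"])
      fix \<epsilon> :: real assume \<epsilon>: "0 < \<epsilon>" "\<epsilon> \<le> 1"
      have "sqrt (lam (?n \<epsilon> 1)) \<le> minimal_error (tensor_space tH 1) (tensor_space tG 1)
          (tensor_operator tH tG S1 1) (?n \<epsilon> 1)"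
        by (rule P.minimal_error_lower) simp
      also have "\<dots> \<le> \<epsilon>"
        using P.complexity_upper(2)[of "I 1", OF _ \<epsilon>(1)] P.antisymmetric_space_singleton[of 1]
        unfolding antisym_complexity_def I1 by simp
      finally have "lam (?n \<epsilon> 1) \<le> \<epsilon>\<^sup>2" by (rule sqrt_le_D)
      \<comment> \<open>At \<open>d = 1\<close> the factor \<open>real d powr q\<close> is 1,
        whatever \<open>q\<close> is.\<close>
      moreover have "real (?n \<epsilon> 1) \<le> C * \<epsilon> powr (- p)" using Cp(3)[of \<epsilon> 1] \<epsilon> by simp
      ultimately show "real (?n \<epsilon> 1) \<le> C * \<epsilon> powr (- p) \<and> lam (?n \<epsilon> 1) \<le> \<epsilon>\<^sup>2" by blast
    qed
    then show ?thesis using Cp(2) by blast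
  qed
  have "strongly_polynomially_tractable ?n \<Longrightarrow> polynomially_tractable ?n"
    unfolding strongly_polynomially_tractable_def polynomially_tractable_def by blast
  then show ?thesis using strong summ by blast
qed

end
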